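(* Let $\Gamma=(I,E,m)$ be a finite simplicial labelled graph. There exists a family of maps $\pi^*_{Z,X}:(\Sigma_Z\cup\Sigma_Z^{-1})^*\to(\Sigma_X\cup\Sigma_X^{-1})^*$, indexed by the pairs of subsets $X\subseteq Z\subseteq I$, such that for all $X\subseteq Z\subseteq I$: (i) For any word $\omega$ on $\Sigma_Z\cup\Sigma_Z^{-1}$, the length of the word $\pi^*_{Z,X}(\omega)$ is at most the length of the word $\omega$. Equality holds if and only if $\omega$ is a word on $\Sigma_X\cup\Sigma_X^{-1}$, and in that case $\pi^*_{Z,X}(\omega)=\omega$. (ii) If $\omega,\omega'$ are words on $\Sigma_Z\cup\Sigma_Z^{-1}$, then $\pi^*_{Z,X}(\omega)$ is a prefix of $\pi^*_{Z,X}(\omega\omega')$. (iii) The map $\pi^*_{Z,X}$ induces a map $\pi_{Z,X}:A_Z\to A_X$ (that is, two words representing the same element of $A_Z$ have images representing the same element of $A_X$). (iv) For every $g\in A_Z$, the element $\theta_X(\pi_{Z,X}(g))^{-1}\theta_Z(g)$ of $W_Z$ is $(X,\emptyset)$-reduced, and $\ell_Z(\theta_Z(g))=\ell_Z\big(\theta_X(\pi_{Z,X}(g))\big)+\ell_Z\big(\theta_X(\pi_{Z,X}(g))^{-1}\theta_Z(g)\big)$. (v) The map $\pi_{Z,X}$ restricts to a group homomorphism $CA_Z\to CA_X$. (vi) $\pi_{Z,X}(A_Z^+)=A_X^+$. (vii) For any word $\omega$ on $\Sigma_X\cup\Sigma_X^{-1}$, representing $g\in A_Z$, and any $g'\in A_Z$,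 one has $\pi_{Z,X}(gg')=\pi_{Z,X}(g)\,\pi_{Z,X}(g')$. (viii) For any $g\in CA_Z$ and any $g'\in A_Z$, one has $\pi_{Z,X}(gg')=\pi_{Z,X}(g)\,\pi_{Z,X}(g')$. (ix) If $Y\subseteq Z$ and $\omega$ is a word on $\Sigma_Y\cup\Sigma_Y^{-1}$, then $\pi^*_{Z,X}(\omega)$ is a word on $\Sigma_{Y\cap X}\cup\Sigma_{Y\cap X}^{-1}$, and the restriction of $\pi^*_{Z,X}$ to $(\Sigma_Y\cup\Sigma_Y^{-1})^*$ is $\pi^*_{Y,Y\cap X}$. (x) If $Y\subseteq Z$ and $\omega$ is a word on $\Sigma_Z\cup\Sigma_Z^{-1}$, then $\pi^*_{Z,Y}(\pi^*_{Z,X}(\omega))=\pi^*_{Z,X}(\pi^*_{Z,Y}(\omega))=\pi^*_{Z,X\cap Y}(\omega)$. (xi) If $X\subseteq Y\subseteq Z$ and $\omega$ is a word on $\Sigma_Z\cup\Sigma_Z^{-1}$, then $\pi^*_{Y,X}(\pi^*_{Z,Y}(\omega))=\pi^*_{Z,X}(\omega)$.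
   Context: $\Gamma=(I,E,m)$ is a finite simplicial graph with edge labelling $m:E\to\mathbb{N}_{\ge 2}$; write $m(i,j)=m(\{i,j\})$. Let $\Sigma_I=\{\sigma_i\mid i\in I\}$ and $S_I=\{s_i\mid i\in I\}$. For $Z\subseteq I$, put $\Sigma_Z=\{\sigma_i\mid i\in Z\}$, $S_Z=\{s_i\mid i\in Z\}$, and let $\Gamma_Z$ be the full labelled subgraph spanned by $Z$. The Artin-Tits group $A_Z$ is the group presented by generators $\Sigma_Z$ and relations $\sigma_i\sigma_j\sigma_i\cdots=\sigma_j\sigma_i\sigma_j\cdots$ ($m(i,j)$ terms on each side) for each edge $\{i,j\}$ of $\Gamma_Z$; the Coxeter group $W_Z$ is presented by generators $S_Z$ and relations $s_i^2=1$ ($i\in Z$) and $s_is_js_i\cdots=s_js_is_j\cdots$ ($m(i,j)$ terms on each side) for each edge $\{i,j\}$ of $\Gamma_Z$. (Here $A_X$ is the abstractly presented group; it is not assumed to be identified with a subgroup of $A_Z$. On the other hand, for $X\subseteq Z$, $W_X$ is identified with the subgroup of $W_Z$ generated by $S_X$, as is well known to be possible.) Let $\theta_Z:A_Z\to W_Z$ be the morphism $\sigma_i\mapsto s_i$ and $CA_Z=\ker\theta_Z$. Let $A_Z^+$ be the submonoid of $A_Z$ generated by $\Sigma_Z$. For a set $S$, $S^*$ is the monoid of words on $S$ (words are not assumed to be freely reduced); words on $\Sigma_X\cup\Sigma_X^{-1}$ are viewed as words on $\Sigma_Z\cup\Sigma_Z^{-1}$ when $X\subseteq Z$. For $w\in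 W_Z$, $\ell_Z(w)$ is the minimal length of a word on $S_Z$ representing $w$. For subsets $X,Y\subseteq Z$, an element $w\in W_Z$ is $(X,Y)$-reduced if it is the (unique) element of minimal length in the double coset $W_XwW_Y$; in particular $(X,\emptyset)$-reduced means of minimal length in $W_Xw$. *)

theory Defs
  imports "HOL.Hull" "HOL-Algebra.Generated_Groups" "HOL-Library.Sublist"
begin

section \<open>Words and groups given by presentations\<close>

text \<open>The letter \<open>(a, True)\<close> stands for the generator \<open>a\<close> and \<open>(a, False)\<close> for its formal inverse.
  Words need not be freely reduced.\<close>

type_synonym 'a word = "('a \<times> bool) list"

definition words :: "'a set \<Rightarrow> 'a word set"
  where "words S = lists (S \<times> UNIV)"

definition pos_word :: "'a list \<Rightarrow> 'a word"
  where "pos_word xs = map (\<lambda>a. (a, True)) xs"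

text \<open>The congruence on the monoid \<open>words S\<close> generated by free cancellation and the relators
  \<open>l = r\<close> with \<open>(l, r) \<in> R\<close>. Only words over \<open>S\<close> occur, so the group presented on a smaller set of
  generators is not by construction a subgroup of the larger one.\<close>

inductive_set pres_rel :: "'a set \<Rightarrow> ('a word \<times> 'a word) set \<Rightarrow> ('a word \<times> 'a word) set"
  for S :: "'a set" and R :: "('a word \<times> 'a word) set" where
  refl: "u \<in> words S \<Longrightarrow> (u, u) \<in> pres_rel S R"
| sym: "(u, v) \<in> pres_rel S R \<Longrightarrow> (v, u) \<in> pres_rel S R"
| trans: "(u, v) \<in> pres_rel S R \<Longrightarrow> (v, w) \<in> pres_rel S R \<Longrightarrow> (u, w) \<in> pres_rel S R"
| cancel: "u \<in> words S \<Longrightarrow> v \<in> words S \<Longrightarrow> a \<in> S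
    \<Longrightarrow> (u @ [(a, b), (a, \<not> b)] @ v, u @ v) \<in> pres_rel S R"
| relator: "u \<in> words S \<Longrightarrow> v \<in> words S \<Longrightarrow> (l, r) \<in> R \<Longrightarrow> l \<in> words S \<Longrightarrow> r \<in> words S
    \<Longrightarrow> (u @ l @ v, u @ r @ v) \<in> pres_rel S R"

definition pres_class :: "'a set \<Rightarrow> ('a word \<times> 'a word) set \<Rightarrow> 'a word \<Rightarrow> 'a word set"
  where "pres_class S R u = pres_rel S R `` {u}"

definition pres_group :: "'a set \<Rightarrow> ('a word \<times> 'a word) set \<Rightarrow> 'a word set monoid"
  where "pres_group S R =
    \<lparr>carrier = words S // pres_rel S R,
     monoid.mult = (\<lambda>A B. \<Union>u\<in>A. \<Union>v\<in>B. pres_class S R (u @ v)),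
     monoid.one = pres_class S R []\<rparr>"

text \<open>The map into \<open>pres_group S R\<close> sending each generator to the generator of the same name, defined
  on classes of words. It is a well-defined morphism on \<open>pres_group S' R'\<close> whenever \<open>S' \<subseteq> S\<close> and
  \<open>R' \<subseteq> R\<close>, see \<open>pres_map_hom\<close> and \<open>pres_map_class\<close> below.\<close>

definition pres_map :: "'a set \<Rightarrow> ('a word \<times> 'a word) set \<Rightarrow> 'a word set \<Rightarrow> 'a word set"
  where "pres_map S R A = (\<Union>u\<in>A. pres_class S R u)"

lemma words_Nil [simp]: "[] \<in> words S"
  and words_append [simp]: "u @ v \<in> words S \<longleftrightarrow> u \<in> words S \<and> v \<in> words S"
  and words_Cons [simp]: "(a, b) # u \<in> words S \<longleftrightarrow> a \<in> S \<and> u \<in> words S"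
  by (auto simp: words_def)

lemma words_mono: "S' \<subseteq> S \<Longrightarrow> words S' \<subseteq> words S"
  unfolding words_def by (intro lists_mono) auto

lemma pres_rel_words: "(u, v) \<in> pres_rel S R \<Longrightarrow> u \<in> words S \<and> v \<in> words S"
  by (induction rule: pres_rel.induct) auto

lemma equiv_pres_rel: "equiv (words S) (pres_rel S R)"
  by (intro equivI refl_onI symI transI subsetI)
    (auto intro: pres_rel.intros dest: pres_rel_words)

lemma pres_rel_context:
  assumes "(u, v) \<in> pres_rel S R" "x \<in> words S" "y \<in> words S"
  shows "(x @ u @ y, x @ v @ y) \<in> pres_rel S R"
  using assms
proof (induction rule: pres_rel.induct)
  case (cancel u v a b)
  then show ?case using pres_rel.cancel[of "x @ u" S "v @ y" a b R] by simp
next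
  case (relator u v l r)
  then show ?case using pres_rel.relator[of "x @ u" S "v @ y" l r R] by simp
qed (auto intro: pres_rel.intros)

lemma pres_rel_append:
  assumes "(u, u') \<in> pres_rel S R" "(v, v') \<in> pres_rel S R"
  shows "(u @ v, u' @ v') \<in> pres_rel S R"
proof -
  have "(u @ v, u' @ v) \<in> pres_rel S R"
    using pres_rel_context[OF assms(1), of "[]" v] assms by (auto dest: pres_rel_words)
  moreover have "(u' @ v, u' @ v') \<in> pres_rel S R"
    using pres_rel_context[OF assms(2), of u' "[]"] assms by (auto dest: pres_rel_words)
  ultimately show ?thesis by (rule pres_rel.trans)
qed

lemma pres_rel_mono:
  assumes "S' \<subseteq> S" "R' \<subseteq> R" "(u, v) \<in> pres_rel S' R'"
  shows "(u, v) \<in> pres_rel S R"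
  using assms(3)
proof (induction rule: pres_rel.induct)
  case (cancel u v a b)
  then show ?case using words_mono[OF assms(1)] assms(1) by (intro pres_rel.cancel) auto
next
  case (relator u v l r)
  then show ?case using words_mono[OF assms(1)] assms(2) by (intro pres_rel.relator) auto
qed (use words_mono[OF assms(1)] in \<open>auto intro: pres_rel.intros\<close>)

lemma pres_class_eq_iff:
  "u \<in> words S \<Longrightarrow> v \<in> words S
    \<Longrightarrow> pres_class S R u = pres_class S R v \<longleftrightarrow> (u, v) \<in> pres_rel S R"
  unfolding pres_class_def by (rule eq_equiv_class_iff[OF equiv_pres_rel])

lemma mem_pres_class: "v \<in> pres_class S R u \<longleftrightarrow> (u, v) \<in> pres_rel S R"
  by (simp add: pres_class_def)

lemma carrier_pres_group: "carrier (pres_group S R) = pres_class S R ` words S"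
  by (auto simp: pres_group_def quotient_def pres_class_def)

lemma one_pres_group: "\<one>\<^bsub>pres_group S R\<^esub> = pres_class S R []"
  by (simp add: pres_group_def)

lemma mult_pres_group:
  assumes "u \<in> words S" "v \<in> words S"
  shows "pres_class S R u \<otimes>\<^bsub>pres_group S R\<^esub> pres_class S R v = pres_class S R (u @ v)"
proof -
  have *: "pres_class S R (u' @ v') = pres_class S R (u @ v)"
    if "u' \<in> pres_class S R u" "v' \<in> pres_class S R v" for u' v'
    using that pres_rel_append[of u u' S R v v']
    by (subst pres_class_eq_iff) (auto simp: mem_pres_class assms dest: pres_rel_words intro: pres_rel.sym)
  have "u \<in> pres_class S R u" "v \<in> pres_class S R v"
    using assms by (auto simp: mem_pres_class intro: pres_rel.refl)
  then have "(\<Union>u'\<in>pres_class S R u. \<Union>v'\<in>pres_class S R v. pres_class S R (u @ v))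
      = pres_class S R (u @ v)"
    by (metis UN_constant empty_iff)
  then show ?thesis using * by (simp add: pres_group_def cong: SUP_cong)
qed

definition inv_word :: "'a word \<Rightarrow> 'a word"
  where "inv_word u = rev (map (\<lambda>(a, b). (a, \<not> b)) u)"

lemma inv_word_words: "u \<in> words S \<Longrightarrow> inv_word u \<in> words S"
  by (auto simp: words_def inv_word_def in_lists_conv_set)

lemma pres_rel_inv_word: "u \<in> words S \<Longrightarrow> (inv_word u @ u, []) \<in> pres_rel S R"
proof (induction u)
  case Nil
  then show ?case by (auto simp: inv_word_def intro: pres_rel.refl)
next
  case (Cons x u)
  obtain a b where x: "x = (a, b)" by force
  have "(inv_word u @ [(a, \<not> b), (a, \<not> \<not> b)] @ u, inv_word u @ u) \<in> pres_rel S R"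
    using Cons.prems inv_word_words[of u S] by (intro pres_rel.cancel) (auto simp: x)
  with Cons show ?case by (auto simp: x inv_word_def intro: pres_rel.trans)
qed

lemma group_pres_group: "group (pres_group S R)"
proof (rule groupI)
  fix A assume "A \<in> carrier (pres_group S R)"
  then obtain u where u: "u \<in> words S" "A = pres_class S R u"
    by (auto simp: carrier_pres_group)
  then show "\<exists>B\<in>carrier (pres_group S R). B \<otimes>\<^bsub>pres_group S R\<^esub> A = \<one>\<^bsub>pres_group S R\<^esub>"
    using inv_word_words[OF u(1)] pres_rel_inv_word[OF u(1), of R]
    by (intro bexI[of _ "pres_class S R (inv_word u)"])
      (auto simp: carrier_pres_group mult_pres_group one_pres_group pres_class_eq_iff)
qed (auto simp: carrier_pres_group mult_pres_group one_pres_group)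

lemma pres_map_class:
  assumes "S' \<subseteq> S" "R' \<subseteq> R" "u \<in> words S'"
  shows "pres_map S R (pres_class S' R' u) = pres_class S R u"
proof -
  have "pres_class S R v = pres_class S R u" if "v \<in> pres_class S' R' u" for v
    using pres_rel_mono[OF assms(1,2), of u v] that
    by (subst pres_class_eq_iff) (auto simp: mem_pres_class dest: pres_rel_words intro: pres_rel.sym)
  moreover have "u \<in> pres_class S' R' u"
    using assms(3) by (auto simp: mem_pres_class intro: pres_rel.refl)
  ultimately show ?thesis
    unfolding pres_map_def by (metis SUP_eq_const empty_iff)
qed

lemma pres_map_hom:
  assumes "S' \<subseteq> S" "R' \<subseteq> R"
  shows "pres_map S R \<in> hom (pres_group S' R') (pres_group S R)"
  using words_mono[OF assms(1)]
  by (intro homI) (auto simp: carrier_pres_group mult_pres_group pres_map_class[OF assms] subset_iff)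

section \<open>Artin-Tits groups and Coxeter groups\<close>

text \<open>Only the values of the labelling on edges are meaningful.\<close>

record 'i lgraph =
  verts :: "'i set"
  edges :: "'i set set"
  label :: "'i set \<Rightarrow> nat"

definition finite_labelled_graph :: "'i lgraph \<Rightarrow> bool"
  where "finite_labelled_graph \<Gamma> \<longleftrightarrow>
    finite (verts \<Gamma>) \<and>
    (\<forall>e\<in>edges \<Gamma>. e \<subseteq> verts \<Gamma> \<and> card e = 2) \<and>
    (\<forall>e\<in>edges \<Gamma>. label \<Gamma> e \<ge> 2)"

definition full_subgraph :: "'i lgraph \<Rightarrow> 'i set \<Rightarrow> 'i lgraph"
  where "full_subgraph \<Gamma> Z = \<Gamma>\<lparr>verts := Z, edges := {e \<in> edges \<Gamma>. e \<subseteq> Z}\<rparr>"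

fun alternating :: "'i \<Rightarrow> 'i \<Rightarrow> nat \<Rightarrow> 'i list" where
  "alternating i j 0 = []"
| "alternating i j (Suc n) = i # alternating j i n"

definition braid_relators :: "'i lgraph \<Rightarrow> ('i word \<times> 'i word) set"
  where "braid_relators \<Gamma> =
    {(pos_word (alternating i j (label \<Gamma> {i, j})), pos_word (alternating j i (label \<Gamma> {i, j}))) | i j.
      {i, j} \<in> edges \<Gamma>}"

definition coxeter_relators :: "'i lgraph \<Rightarrow> ('i word \<times> 'i word) set"
  where "coxeter_relators \<Gamma> = {(pos_word [i, i], []) | i. i \<in> verts \<Gamma>} \<union> braid_relators \<Gamma>"

text \<open>For \<open>Z \<subseteq> verts \<Gamma>\<close>, the groups \<open>A\<^sub>Z\<close> and \<open>W\<^sub>Z\<close>, together with the element represented by a word.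
  Both generating sets \<open>\<Sigma>\<^sub>Z\<close> and \<open>S\<^sub>Z\<close> are indexed by \<open>Z\<close>.\<close>

definition artin :: "'i lgraph \<Rightarrow> 'i set \<Rightarrow> 'i word set monoid"
  where "artin \<Gamma> Z = pres_group Z (braid_relators (full_subgraph \<Gamma> Z))"

definition artin_elt :: "'i lgraph \<Rightarrow> 'i set \<Rightarrow> 'i word \<Rightarrow> 'i word set"
  where "artin_elt \<Gamma> Z \<omega> = pres_class Z (braid_relators (full_subgraph \<Gamma> Z)) \<omega>"

definition coxeter :: "'i lgraph \<Rightarrow> 'i set \<Rightarrow> 'i word set monoid"
  where "coxeter \<Gamma> Z = pres_group Z (coxeter_relators (full_subgraph \<Gamma> Z))"

definition coxeter_elt :: "'i lgraph \<Rightarrow> 'i set \<Rightarrow> 'i word \<Rightarrow> 'i word set"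
  where "coxeter_elt \<Gamma> Z \<omega> = pres_class Z (coxeter_relators (full_subgraph \<Gamma> Z)) \<omega>"

definition artin_gens :: "'i lgraph \<Rightarrow> 'i set \<Rightarrow> 'i word set set"
  where "artin_gens \<Gamma> Z = (\<lambda>i. artin_elt \<Gamma> Z [(i, True)]) ` Z"

text \<open>For \<open>X \<subseteq> Z\<close>, \<open>coxeter_gens \<Gamma> Z X\<close> is \<open>S\<^sub>X\<close> as a subset of \<open>W\<^sub>Z\<close>.\<close>

definition coxeter_gens :: "'i lgraph \<Rightarrow> 'i set \<Rightarrow> 'i set \<Rightarrow> 'i word set set"
  where "coxeter_gens \<Gamma> Z X = (\<lambda>i. coxeter_elt \<Gamma> Z [(i, True)]) ` X"

text \<open>The morphism \<open>\<theta>\<^sub>Z : A\<^sub>Z \<rightarrow> W\<^sub>Z\<close>, \<open>\<sigma>\<^sub>i \<mapsto> s\<^sub>i\<close>, and its kernel \<open>CA\<^sub>Z\<close>.\<close>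

definition theta :: "'i lgraph \<Rightarrow> 'i set \<Rightarrow> 'i word set \<Rightarrow> 'i word set"
  where "theta \<Gamma> Z = pres_map Z (coxeter_relators (full_subgraph \<Gamma> Z))"

definition colored_artin :: "'i lgraph \<Rightarrow> 'i set \<Rightarrow> 'i word set set"
  where "colored_artin \<Gamma> Z = kernel (artin \<Gamma> Z) (coxeter \<Gamma> Z) (theta \<Gamma> Z)"

text \<open>The submonoid \<open>A\<^sub>Z\<^sup>+\<close>.\<close>

definition artin_pos :: "'i lgraph \<Rightarrow> 'i set \<Rightarrow> 'i word set set"
  where "artin_pos \<Gamma> Z = (\<lambda>M. submonoid M (artin \<Gamma> Z)) hull artin_gens \<Gamma> Z"

text \<open>The morphism \<open>W\<^sub>X \<rightarrow> W\<^sub>Z\<close>, \<open>s\<^sub>i \<mapsto> s\<^sub>i\<close> (for \<open>X \<subseteq> Z\<close>), along which \<open>W\<^sub>X\<close> is identified with the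
  subgroup of \<open>W\<^sub>Z\<close> generated by \<open>S\<^sub>X\<close>. It depends on \<open>X\<close> only through its domain.\<close>

definition coxeter_incl :: "'i lgraph \<Rightarrow> 'i set \<Rightarrow> 'i word set \<Rightarrow> 'i word set"
  where "coxeter_incl \<Gamma> Z = pres_map Z (coxeter_relators (full_subgraph \<Gamma> Z))"

definition coxeter_length :: "'i lgraph \<Rightarrow> 'i set \<Rightarrow> 'i word set \<Rightarrow> nat"
  where "coxeter_length \<Gamma> Z w =
    (LEAST n. \<exists>s\<in>lists Z. length s = n \<and> coxeter_elt \<Gamma> Z (pos_word s) = w)"

definition double_coset ::
  "'i lgraph \<Rightarrow> 'i set \<Rightarrow> 'i set \<Rightarrow> 'i set \<Rightarrow> 'i word set \<Rightarrow> 'i word set set"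
  where "double_coset \<Gamma> Z X Y w =
    (generate (coxeter \<Gamma> Z) (coxeter_gens \<Gamma> Z X) #>\<^bsub>coxeter \<Gamma> Z\<^esub> w)
      <#>\<^bsub>coxeter \<Gamma> Z\<^esub> generate (coxeter \<Gamma> Z) (coxeter_gens \<Gamma> Z Y)"

text \<open>The strict inequality makes \<open>w\<close> the unique element of minimal length in its double coset.\<close>

definition reduced ::
  "'i lgraph \<Rightarrow> 'i set \<Rightarrow> 'i set \<Rightarrow> 'i set \<Rightarrow> 'i word set \<Rightarrow> bool"
  where "reduced \<Gamma> Z X Y w \<longleftrightarrow>
    w \<in> carrier (coxeter \<Gamma> Z) \<and>
    (\<forall>u\<in>double_coset \<Gamma> Z X Y w. u \<noteq> w \<longrightarrow> coxeter_length \<Gamma> Z w < coxeter_length \<Gamma> Z u)"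

lemma group_artin: "group (artin \<Gamma> Z)"
  and group_coxeter: "group (coxeter \<Gamma> Z)"
  by (simp_all add: artin_def coxeter_def group_pres_group)

lemma carrier_artin: "carrier (artin \<Gamma> Z) = artin_elt \<Gamma> Z ` words Z"
  and carrier_coxeter: "carrier (coxeter \<Gamma> Z) = coxeter_elt \<Gamma> Z ` words Z"
  by (simp_all add: artin_def artin_elt_def[abs_def] coxeter_def coxeter_elt_def[abs_def]
      carrier_pres_group)

lemma theta_artin_elt: "\<omega> \<in> words Z \<Longrightarrow> theta \<Gamma> Z (artin_elt \<Gamma> Z \<omega>) = coxeter_elt \<Gamma> Z \<omega>"
  unfolding theta_def artin_elt_def coxeter_elt_def
  by (rule pres_map_class) (auto simp: coxeter_relators_def)

lemma theta_hom: "theta \<Gamma> Z \<in> hom (artin \<Gamma> Z) (coxeter \<Gamma> Z)"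
  unfolding theta_def artin_def coxeter_def
  by (rule pres_map_hom) (auto simp: coxeter_relators_def)

lemma coxeter_relators_mono:
  "X \<subseteq> Z \<Longrightarrow> coxeter_relators (full_subgraph \<Gamma> X) \<subseteq> coxeter_relators (full_subgraph \<Gamma> Z)"
  unfolding coxeter_relators_def braid_relators_def full_subgraph_def by simp blast

lemma coxeter_incl_coxeter_elt:
  "X \<subseteq> Z \<Longrightarrow> \<omega> \<in> words X \<Longrightarrow> coxeter_incl \<Gamma> Z (coxeter_elt \<Gamma> X \<omega>) = coxeter_elt \<Gamma> Z \<omega>"
  unfolding coxeter_incl_def coxeter_elt_def by (intro pres_map_class coxeter_relators_mono)

lemma coxeter_incl_hom:
  "X \<subseteq> Z \<Longrightarrow> coxeter_incl \<Gamma> Z \<in> hom (coxeter \<Gamma> X) (coxeter \<Gamma> Z)"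
  unfolding coxeter_incl_def coxeter_def by (intro pres_map_hom coxeter_relators_mono)

end

theory Submission
  imports Defs Complex_Main
begin

text \<open>A word \<open>\<omega>\<close> over \<open>Z\<close> is a gallery in the Coxeter complex of \<open>W\<close>: its \<open>k\<close>-th letter crosses the
  wall of the reflection \<open>s\<^sub>1 \<dots> s\<^sub>k \<dots> s\<^sub>1\<close>. The retraction \<open>\<pi>\<^sup>*\<close> is what remains of the gallery when it is
  projected to the residue of the standard parabolic subgroup \<open>W\<^sub>X\<close>. Only the crossings of walls of
  \<open>W\<^sub>X\<close> survive, with their order and signs. Concretely, write the current element as \<open>v b\<close> with
  \<open>v \<in> W\<^sub>X\<close> and \<open>b\<close> the shortest element of its coset. For each letter \<open>s\<^sub>i\<close> either \<open>b s\<^sub>i\<close> is again the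
  shortest element of its coset, and the letter is dropped, or \<open>b s\<^sub>i = s\<^sub>x b\<close> with \<open>x \<in> X\<close>, and the
  letter is replaced by \<open>\<sigma>\<^sub>x\<close> with the same sign (\<open>min_rep_step\<close>).

  The recursive definition gives the prefix and length properties. It also makes the map
  multiplicative when the first factor ends at the representative \<open>b = 1\<close>, as words over \<open>X\<close> and
  words of coloured elements do. The description by walls (\<open>walls_retract\<close>) makes successive
  retractions intersect: filtering by \<open>W\<^sub>X\<close> and by \<open>W\<^sub>Y\<close> is filtering by \<open>W\<^sub>X \<inter> W\<^sub>Y = W\<^sub>X\<^sub>\<inter>\<^sub>Y\<close>
  (\<open>parabolic_Int\<close>). Neither description mentions \<open>Z\<close>, so one works in the Coxeter group of the whole graph
  throughout.

  The heart of the matter is that braid relations go to braid relations (\<open>retract_braid\<close>). The two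
  sides of a braid relation cross the same walls in opposite orders. Hence their retractions agree if
  just one letter can survive. Two letters can survive only if the coset representative \<open>b\<close> at which
  the words start conjugates \<open>s\<^sub>i\<close> and \<open>s\<^sub>j\<close> to two generators \<open>s\<^sub>x\<close> and \<open>s\<^sub>y\<close>. To conclude that
  \<open>{x, y}\<close> is an edge with the same label one needs that \<open>s\<^sub>x s\<^sub>y\<close> has exactly the order that the presentation prescribes
  (\<open>elt_alt_eqD\<close>), which is where the geometric representation enters.

  The other facts on Coxeter groups come from the exchange condition, which is obtained
  combinatorially from the parity of the number of times that a word crosses a wall
  (\<open>walls_parity\<close>). That the Coxeter group of \<open>X\<close> embeds into \<open>W\<close> is itself a consequence of the
  retraction, which respects the relations of Coxeter groups as well (\<open>cox_rel_iff\<close>).\<close>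

section \<open>Alternating words and products of classes\<close>

lemma words_Cons' [simp]: "p # u \<in> words S \<longleftrightarrow> fst p \<in> S \<and> u \<in> words S"
  by (cases p) simp

lemma words_rev [simp]: "rev \<omega> \<in> words S \<longleftrightarrow> \<omega> \<in> words S"
  by (induction \<omega>) auto

lemma words_subseq: "subseq u v \<Longrightarrow> v \<in> words S \<Longrightarrow> u \<in> words S"
  by (auto simp: words_def in_lists_conv_set dest: list_emb_set)

lemma pos_word_simps [simp]:
  "pos_word [] = []" "pos_word (i # xs) = (i, True) # pos_word xs"
  "length (pos_word xs) = length xs" "pos_word xs \<in> words S \<longleftrightarrow> set xs \<subseteq> S"
  by (induction xs) (auto simp: pos_word_def)

lemma pos_word_append: "pos_word (xs @ ys) = pos_word xs @ pos_word ys"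
  by (simp add: pos_word_def)

lemma pos_word_rev: "pos_word (rev xs) = rev (pos_word xs)"
  by (simp add: pos_word_def rev_map)

lemma length_alternating [simp]: "length (alternating i j n) = n"
  by (induction n arbitrary: i j) auto

lemma set_alternating: "set (alternating i j n) \<subseteq> {i, j}"
proof (induction n arbitrary: i j)
  case (Suc n)
  from Suc[of j i] show ?case by auto
qed simp

lemma alternating_words: "i \<in> S \<Longrightarrow> j \<in> S \<Longrightarrow> pos_word (alternating i j n) \<in> words S"
  using set_alternating[of i j n] by auto

lemma alternating_add:
  "alternating i j (k + n) =
    alternating i j k @ (if even k then alternating i j n else alternating j i n)"
  by (induction k arbitrary: i j) auto

lemma rev_alternating:
  "rev (alternating i j n) = (if even n then alternating j i n else alternating i j n)"
proof (induction n arbitrary: i j)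
  case (Suc n)
  have "alternating a b (Suc n) = alternating a b n @ [if even n then a else b]" for a b :: 'a
    using alternating_add[of a b n 1] by auto
  moreover have "rev (alternating i j (Suc n)) = rev (alternating j i n) @ [i]" by simp
  ultimately show ?case using Suc[of j i] by (simp del: alternating.simps)
qed simp

lemma braid_relators_iff:
  "(l, r) \<in> braid_relators (full_subgraph \<Gamma> X) \<longleftrightarrow>
    (\<exists>i j. {i, j} \<in> edges \<Gamma> \<and> i \<in> X \<and> j \<in> X \<and>
      l = pos_word (alternating i j (label \<Gamma> {i, j})) \<and>
      r = pos_word (alternating j i (label \<Gamma> {i, j})))"
  by (auto simp: braid_relators_def full_subgraph_def)

lemma mult_artin_elt:
  "u \<in> words Z \<Longrightarrow> v \<in> words Z \<Longrightarrow>
    artin_elt \<Gamma> Z u \<otimes>\<^bsub>artin \<Gamma> Z\<^esub> artin_elt \<Gamma> Z v = artin_elt \<Gamma> Z (u @ v)"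
  by (simp add: artin_elt_def artin_def mult_pres_group)

lemma mult_coxeter_elt:
  "u \<in> words Z \<Longrightarrow> v \<in> words Z \<Longrightarrow>
    coxeter_elt \<Gamma> Z u \<otimes>\<^bsub>coxeter \<Gamma> Z\<^esub> coxeter_elt \<Gamma> Z v = coxeter_elt \<Gamma> Z (u @ v)"
  by (simp add: coxeter_elt_def coxeter_def mult_pres_group)

lemma one_artin: "\<one>\<^bsub>artin \<Gamma> Z\<^esub> = artin_elt \<Gamma> Z []"
  and one_coxeter: "\<one>\<^bsub>coxeter \<Gamma> Z\<^esub> = coxeter_elt \<Gamma> Z []"
  by (simp_all add: artin_elt_def artin_def coxeter_elt_def coxeter_def one_pres_group)

section \<open>Words in a Coxeter group and their reflections\<close>

text \<open>The group is written additively although it is not commutative, which the class \<open>group_add\<close>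
  does not require. Signs of letters are irrelevant to the element that a word represents, as
  the generators are involutions; they are carried along because the same words represent elements of
  Artin-Tits groups. Only words over all of \<open>verts \<Gamma>\<close> are assumed to be represented faithfully. That
  the subgroup generated by \<open>X\<close> is the Coxeter group of \<open>X\<close> is a theorem below.\<close>

locale coxeter_system =
  fixes \<Gamma> :: "'i lgraph" and s :: "'i \<Rightarrow> 'g::group_add"
  assumes graph: "finite_labelled_graph \<Gamma>"
    and faithful: "\<And>u v. u \<in> words (verts \<Gamma>) \<Longrightarrow> v \<in> words (verts \<Gamma>) \<Longrightarrow>
      (\<Sum>p\<leftarrow>u. s (fst p)) = (\<Sum>p\<leftarrow>v. s (fst p))
        \<longleftrightarrow> (u, v) \<in> pres_rel (verts \<Gamma>) (coxeter_relators (full_subgraph \<Gamma> (verts \<Gamma>)))"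
begin

abbreviation I :: "'i set"
  where "I \<equiv> verts \<Gamma>"

abbreviation cox_rel :: "'i set \<Rightarrow> ('i word \<times> 'i word) set"
  where "cox_rel X \<equiv> pres_rel X (coxeter_relators (full_subgraph \<Gamma> X))"

abbreviation art_rel :: "'i set \<Rightarrow> ('i word \<times> 'i word) set"
  where "art_rel X \<equiv> pres_rel X (braid_relators (full_subgraph \<Gamma> X))"

definition elt :: "'i word \<Rightarrow> 'g"
  where "elt \<omega> = (\<Sum>p\<leftarrow>\<omega>. s (fst p))"

definition conjugate :: "'g \<Rightarrow> 'g \<Rightarrow> 'g"
  where "conjugate a t = a + t - a"

definition parabolic :: "'i set \<Rightarrow> 'g set"
  where "parabolic X = elt ` words X"

lemma elt_Nil [simp]: "elt [] = 0"
  and elt_Cons [simp]: "elt (p # \<omega>) = s (fst p) + elt \<omega>"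
  and elt_append [simp]: "elt (u @ v) = elt u + elt v"
  by (simp_all add: elt_def case_prod_beta)

lemma elt_eq_iff: "u \<in> words I \<Longrightarrow> v \<in> words I \<Longrightarrow> elt u = elt v \<longleftrightarrow> (u, v) \<in> cox_rel I"
  unfolding elt_def by (rule faithful)

lemma edgeD:
  assumes "{i, j} \<in> edges \<Gamma>"
  shows "i \<in> I" "j \<in> I" "i \<noteq> j" "label \<Gamma> {i, j} \<ge> 2"
  using assms graph by (auto simp: finite_labelled_graph_def)

lemma s_s [simp]: "i \<in> I \<Longrightarrow> s i + s i = 0"
proof -
  assume i: "i \<in> I"
  then have "([(i, True), (i, \<not> True)], []) \<in> cox_rel I"
    using pres_rel.cancel[of "[]" I "[]" i True] by simp
  then show ?thesis using i by (simp flip: elt_eq_iff)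
qed

lemma s_cancel [simp]: "i \<in> I \<Longrightarrow> s i + (s i + a) = a"
  by (simp flip: add.assoc)

lemma s_cancel' [simp]: "i \<in> I \<Longrightarrow> a + s i + s i = a"
  by (simp add: add.assoc)

lemma uminus_s [simp]: "i \<in> I \<Longrightarrow> - s i = s i"
  by (simp add: minus_unique)

lemma diff_s [simp]: "i \<in> I \<Longrightarrow> a - s i = a + s i"
  by (metis diff_conv_add_uminus uminus_s)

lemma elt_rev: "\<omega> \<in> words I \<Longrightarrow> elt (rev \<omega>) = - elt \<omega>"
  by (induction \<omega>) (auto simp: minus_add simp del: add_uminus_conv_diff)

lemma zero_parabolic [simp]: "0 \<in> parabolic X"
  unfolding parabolic_def by (rule image_eqI[of _ _ "[]"]) auto

lemma s_parabolic: "x \<in> X \<Longrightarrow> s x \<in> parabolic X"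
  unfolding parabolic_def by (rule image_eqI[of _ _ "[(x, True)]"]) auto

lemma elt_parabolic: "\<omega> \<in> words X \<Longrightarrow> elt \<omega> \<in> parabolic X"
  by (auto simp: parabolic_def)

lemma parabolicE:
  assumes "a \<in> parabolic X"
  obtains \<omega> where "\<omega> \<in> words X" "elt \<omega> = a"
  using assms by (auto simp: parabolic_def)

lemma add_parabolic: "a \<in> parabolic X \<Longrightarrow> b \<in> parabolic X \<Longrightarrow> a + b \<in> parabolic X"
  by (metis elt_append elt_parabolic parabolicE words_append)

lemma uminus_parabolic: "X \<subseteq> I \<Longrightarrow> a \<in> parabolic X \<Longrightarrow> - a \<in> parabolic X"
  using words_mono[of X I] by (auto simp: elt_rev[symmetric] subset_iff elim!: parabolicE intro!: elt_parabolic)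

lemma parabolic_mono: "X \<subseteq> Y \<Longrightarrow> parabolic X \<subseteq> parabolic Y"
  using words_mono[of X Y] by (auto simp: parabolic_def)

lemma diff_parabolic: "X \<subseteq> I \<Longrightarrow> a \<in> parabolic X \<Longrightarrow> b \<in> parabolic X \<Longrightarrow> a - b \<in> parabolic X"
  using add_parabolic[of a X "- b"] uminus_parabolic[of X b] by simp

lemma conjugate_parabolic_iff:
  assumes "X \<subseteq> I" "a \<in> parabolic X"
  shows "conjugate a t \<in> parabolic X \<longleftrightarrow> t \<in> parabolic X"
proof
  assume "conjugate a t \<in> parabolic X"
  then have "- a + conjugate a t + a \<in> parabolic X"
    using assms by (intro add_parabolic uminus_parabolic)
  moreover have "- a + conjugate a t + a = t" by (metis add.assoc conjugate_def diff_add_cancel minus_add_cancel)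
  ultimately show "t \<in> parabolic X" by simp
qed (use assms in \<open>auto simp: conjugate_def intro: add_parabolic diff_parabolic\<close>)

lemma conjugate_0 [simp]: "conjugate 0 t = t"
  by (simp add: conjugate_def)

lemma conjugate_add: "conjugate (a + b) t = conjugate a (conjugate b t)"
  by (simp add: conjugate_def algebra_simps)

lemma conjugate_eq_iff [simp]: "conjugate a t = conjugate a t' \<longleftrightarrow> t = t'"
  by (simp add: conjugate_def diff_eq_eq)

lemma conjugate_eq_conv: "conjugate a t = t' \<longleftrightarrow> a + t = t' + a"
  by (auto simp: conjugate_def diff_eq_eq)

lemma conjugate_add_s [simp]: "i \<in> I \<Longrightarrow> conjugate (a + s i) (s i) = conjugate a (s i)"
  by (simp add: conjugate_add) (simp add: conjugate_def)

text \<open>Reading \<open>\<omega> = s\<^sub>1 \<dots> s\<^sub>n\<close> from the base point \<open>a\<close>, the \<open>k\<close>-th entry is the reflection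
  \<open>a s\<^sub>1 \<dots> s\<^sub>k \<dots> s\<^sub>1 a\<inverse>\<close>, which is the wall crossed by the \<open>k\<close>-th step of the gallery, with the sign
  of that letter.\<close>

primrec walls :: "'g \<Rightarrow> 'i word \<Rightarrow> ('g \<times> bool) list" where
  "walls a [] = []"
| "walls a (p # \<omega>) = (conjugate a (s (fst p)), snd p) # walls (a + s (fst p)) \<omega>"

lemma walls_append: "walls a (u @ v) = walls a u @ walls (a + elt u) v"
  by (induction u arbitrary: a) (auto simp: add.assoc)

lemma length_walls [simp]: "length (walls a \<omega>) = length \<omega>"
  by (induction \<omega> arbitrary: a) auto

lemma walls_add: "walls (a + b) \<omega> = map (apfst (conjugate a)) (walls b \<omega>)"
  by (induction \<omega> arbitrary: b) (auto simp: conjugate_add add.assoc)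

lemma wallsE:
  assumes "(t, e) \<in> set (walls a \<omega>)"
  obtains u p v where "\<omega> = u @ p # v" "t = conjugate (a + elt u) (s (fst p))"
  using assms
proof (induction \<omega> arbitrary: a thesis)
  case (Cons q \<omega>)
  from Cons.prems(2) consider "t = conjugate a (s (fst q))" | "(t, e) \<in> set (walls (a + s (fst q)) \<omega>)"
    by auto
  then show ?case
  proof cases
    case 1
    then show ?thesis using Cons.prems(1)[of "[]" q \<omega>] by simp
  next
    case 2
    then obtain u p v where "\<omega> = u @ p # v" "t = conjugate (a + s (fst q) + elt u) (s (fst p))"
      using Cons.IH by blast
    then show ?thesis using Cons.prems(1)[of "q # u" p v] by (simp add: add.assoc)
  qed
qed simp

abbreviation alt :: "'i \<Rightarrow> 'i \<Rightarrow> nat \<Rightarrow> 'i word"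
  where "alt i j n \<equiv> pos_word (alternating i j n)"

lemma elt_alt_add:
  "elt (alt i j (k + n)) = elt (alt i j k) + elt (if even k then alt i j n else alt j i n)"
  by (simp add: alternating_add pos_word_append)

lemma elt_alt_odd:
  assumes "i \<in> I" "j \<in> I" "elt (alt i j m) = elt (alt j i m)" "k + n = 2 * m" "odd k"
  shows "elt (alt i j k) = elt (alt j i n)"
proof -
  have rev: "elt (if even l then alt a b l else alt b a l) = - elt (alt b a l)"
    if "a \<in> {i, j}" "b \<in> {i, j}" for a b l
    using that elt_rev[of "alt b a l"] alternating_words[of b I a l] assms(1,2)
      rev_alternating[of b a l] by (auto simp flip: pos_word_rev)
  have "elt (alt i j (2 * m)) = elt (alt i j m) - elt (alt j i m)"
    using elt_alt_add[of i j m m] rev[of i j m] by (auto simp: mult_2 simp flip: diff_conv_add_uminus)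
  then have "0 = elt (alt i j k) + elt (alt j i n)"
    using elt_alt_add[of i j k n] assms(3-5) by auto
  moreover have "odd n" using assms(4,5) by presburger
  then have "elt (alt j i n) = - elt (alt j i n)" using rev[of i j n] by simp
  ultimately show ?thesis
    by (metis eq_neg_iff_add_eq_0)
qed

lemma walls_alt_nth:
  assumes "i \<in> I" "j \<in> I" "k < n"
  shows "walls 0 (alt i j n) ! k = (elt (alt i j (2 * k + 1)), True)"
  using assms
proof (induction n arbitrary: i j k)
  case (Suc n)
  show ?case
  proof (cases k)
    case (Suc l)
    have "walls 0 (alt i j (Suc n)) ! k = apfst (conjugate (s i)) (walls 0 (alt j i n) ! l)"
      using Suc Suc.prems walls_add[of "s i" 0] by simp
    also have "\<dots> = (s i + elt (alt j i (2 * l + 1)) + s i, True)"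
      using Suc Suc.prems Suc.IH[of j i l] by (simp add: conjugate_def)
    also have "s i + elt (alt j i (2 * l + 1)) + s i = elt (alt i j (2 * l + 2 + 1))"
      using elt_alt_add[of i j "2 * l + 2" 1] by (simp add: add.assoc)
    finally show ?thesis using Suc by (simp add: mult.commute)
  qed simp
qed simp

text \<open>Both sides of a braid relation cross the same walls, in opposite orders. Indeed the \<open>k\<close>-th wall
  of the left-hand side is an alternating product of length \<open>2k + 1\<close>, and since the full turn of
  length \<open>2m\<close> is trivial, it equals the alternating product of length \<open>2m - 2k - 1\<close> that starts with
  the other letter.\<close>

lemma walls_braid:
  assumes "i \<in> I" "j \<in> I" "elt (alt i j m) = elt (alt j i m)"
  shows "walls a (alt j i m) = rev (walls a (alt i j m))"
proof -
  have "walls 0 (alt j i m) = rev (walls 0 (alt i j m))"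
  proof (rule nth_equalityI)
    fix k assume "k < length (walls 0 (alt j i m))"
    then have k: "k < m" by simp
    have "elt (alt j i (2 * k + 1)) = elt (alt i j (2 * (m - Suc k) + 1))"
      by (rule elt_alt_odd[of j i m]) (use assms k in simp_all)
    then show "walls 0 (alt j i m) ! k = rev (walls 0 (alt i j m)) ! k"
      using k assms walls_alt_nth[of j i k m] walls_alt_nth[of i j "m - Suc k" m]
      by (simp add: rev_nth)
  qed simp
  then show ?thesis using walls_add[of a 0] by (simp add: rev_map)
qed

lemma braid_relator_elt:
  assumes "X \<subseteq> I" "(l, r) \<in> braid_relators (full_subgraph \<Gamma> X)"
  shows "elt l = elt r"
proof -
  from assms have lr: "(l, r) \<in> braid_relators (full_subgraph \<Gamma> I)" "l \<in> words I" "r \<in> words I"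
    by (auto simp: braid_relators_iff simp del: pos_word_simps(4) intro!: alternating_words)
  then have "(l, r) \<in> cox_rel I"
    using pres_rel.relator[of "[]" I "[]" l r] by (auto simp: coxeter_relators_def)
  then show ?thesis using lr by (simp add: elt_eq_iff)
qed

lemma elt_alt_eq: "{i, j} \<in> edges \<Gamma> \<Longrightarrow> elt (alt i j (label \<Gamma> {i, j})) = elt (alt j i (label \<Gamma> {i, j}))"
  using edgeD by (intro braid_relator_elt[of I]) (simp_all only: braid_relators_iff, blast+)

text \<open>How often a word crosses a wall is, modulo 2, an invariant of the element that it
  represents.\<close>

lemma walls_parity:
  assumes "(u, v) \<in> cox_rel I"
  shows "even (count_list (map fst (walls a u)) t) = even (count_list (map fst (walls a v)) t)
    \<and> even (length u) = even (length v) \<and> elt u = elt v"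
  using assms
proof (induction arbitrary: a rule: pres_rel.induct)
  case (cancel u v i b)
  then show ?case by (auto simp: walls_append)
next
  case (relator u v l r)
  have elt: "elt l = elt r"
    using relator pres_rel.relator[of "[]" I "[]" l r] by (simp add: elt_eq_iff)
  have "even (count_list (map fst (walls b l)) t) = even (count_list (map fst (walls b r)) t)
    \<and> even (length l) = even (length r)" for b
  proof (cases "(l, r) \<in> braid_relators (full_subgraph \<Gamma> I)")
    case True
    then obtain i j where "{i, j} \<in> edges \<Gamma>" "i \<in> I" "j \<in> I"
      "l = alt i j (label \<Gamma> {i, j})" "r = alt j i (label \<Gamma> {i, j})"
      by (auto simp: braid_relators_iff)
    then show ?thesis using walls_braid[of i j _ b] elt by (simp flip: rev_map)
  next
    case False
    then obtain i where "l = [(i, True), (i, True)]" "r = []" "i \<in> I"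
      using relator by (auto simp: coxeter_relators_def full_subgraph_def)
    then show ?thesis by simp
  qed
  then show ?case using elt by (auto simp: walls_append)
qed auto

lemma elt_parity:
  assumes "u \<in> words I" "v \<in> words I" "elt u = elt v"
  shows "even (length u) = even (length v)"
  using assms walls_parity elt_eq_iff by blast

section \<open>Length, exchange and minimal coset representatives\<close>

definition len :: "'g \<Rightarrow> nat"
  where "len w = (LEAST n. \<exists>\<omega>\<in>words I. length \<omega> = n \<and> elt \<omega> = w)"

lemma len_elt_le: "\<omega> \<in> words I \<Longrightarrow> len (elt \<omega>) \<le> length \<omega>"
  unfolding len_def by (rule Least_le) auto

lemma geodesicE:
  assumes "w \<in> parabolic I"
  obtains \<omega> where "\<omega> \<in> words I" "length \<omega> = len w" "elt \<omega> = w"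
proof -
  from assms have "\<exists>n. \<exists>\<omega>\<in>words I. length \<omega> = n \<and> elt \<omega> = w" by (auto simp: parabolic_def)
  from LeastI_ex[OF this] show ?thesis by (fold len_def) (use that in blast)
qed

lemma len_add_le:
  assumes "a \<in> parabolic I" "b \<in> parabolic I"
  shows "len (a + b) \<le> len a + len b"
proof -
  obtain u v where "u \<in> words I" "length u = len a" "elt u = a"
    "v \<in> words I" "length v = len b" "elt v = b"
    using assms by (meson geodesicE)
  then show ?thesis using len_elt_le[of "u @ v"] by simp
qed

lemma len_0 [simp]: "len 0 = 0"
  using len_elt_le[of "[]"] by simp

lemma len_eq_0_iff: "w \<in> parabolic I \<Longrightarrow> len w = 0 \<longleftrightarrow> w = 0"
  by (metis elt_Nil geodesicE len_0 length_0_conv)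

lemma len_uminus_le: "w \<in> parabolic I \<Longrightarrow> len (- w) \<le> len w"
  by (metis elt_rev geodesicE len_elt_le length_rev words_rev)

lemma len_uminus: "w \<in> parabolic I \<Longrightarrow> len (- w) = len w"
  using len_uminus_le[of w] len_uminus_le[of "- w"] uminus_parabolic[of I w] by simp

lemma len_parity:
  assumes "\<omega> \<in> words I"
  shows "even (len (elt \<omega>)) = even (length \<omega>)"
  by (metis assms elt_parabolic elt_parity geodesicE)

lemma len_s_add:
  assumes "i \<in> I" "w \<in> parabolic I"
  shows "len (s i + w) = Suc (len w) \<or> Suc (len (s i + w)) = len w"
proof -
  have step: "len (s i + v) \<le> Suc (len v)" if v: "v \<in> parabolic I" for v
  proof -
    obtain \<omega> where "\<omega> \<in> words I" "length \<omega> = len v" "elt \<omega> = v"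
      using v by (rule geodesicE)
    then show ?thesis using len_elt_le[of "(i, True) # \<omega>"] assms(1) by simp
  qed
  obtain \<omega> where "\<omega> \<in> words I" "elt \<omega> = w" using assms(2) by (rule parabolicE)
  then have "even (len (s i + w)) \<noteq> even (len w)"
    using len_parity[of "(i, True) # \<omega>"] len_parity[of \<omega>] assms(1) by simp
  moreover have "len (s i + w) \<le> Suc (len w)" "len w \<le> Suc (len (s i + w))"
    using step[of w] step[of "s i + w"] assms by (auto intro: add_parabolic s_parabolic)
  ultimately show ?thesis by (auto simp: le_Suc_eq)
qed

lemma len_s [simp]: "i \<in> I \<Longrightarrow> len (s i) = 1"
  using len_s_add[of i 0] by simp

lemma s_neq_0: "i \<in> I \<Longrightarrow> s i \<noteq> 0"
  by (metis len_0 len_s zero_neq_one)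

text \<open>A word that crosses a wall twice can be shortened by reflecting the part in between, which
  amounts to deleting the two letters.\<close>

lemma walls_not_distinct:
  assumes "\<omega> \<in> words I" "\<not> distinct (map fst (walls a \<omega>))"
  obtains \<omega>' where "\<omega>' \<in> words I" "length \<omega>' < length \<omega>" "elt \<omega>' = elt \<omega>"
  using assms
proof (induction \<omega> arbitrary: a thesis)
  case (Cons p \<omega>)
  define i where "i = fst p"
  have i: "i \<in> I" and \<omega>: "\<omega> \<in> words I" using Cons.prems by (auto simp: i_def)
  consider "conjugate a (s i) \<in> fst ` set (walls (a + s i) \<omega>)"
    | "\<not> distinct (map fst (walls (a + s i) \<omega>))"
    using Cons.prems by (auto simp: i_def)
  then show ?case
  proof cases
    case 1
    then obtain e where "(conjugate a (s i), e) \<in> set (walls (a + s i) \<omega>)" by force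
    then obtain u q v where uv: "\<omega> = u @ q # v"
      and "conjugate a (s i) = conjugate (a + s i + elt u) (s (fst q))"
      by (rule wallsE)
    then have "conjugate (s i) (s i) = conjugate (s i) (conjugate (elt u) (s (fst q)))"
      using i by (simp add: conjugate_add) (simp add: conjugate_def)
    then have "conjugate (elt u) (s (fst q)) = s i" by simp
    then have "elt u + s (fst q) = s i + elt u" by (simp add: conjugate_eq_conv)
    moreover have "fst q \<in> I" using uv \<omega> by simp
    ultimately have "elt u = s i + elt u + s (fst q)" by (metis s_cancel')
    then have "elt u + elt v = s i + elt u + s (fst q) + elt v"
      by (rule arg_cong[where f = "\<lambda>x. x + elt v"])
    then have "elt (u @ v) = elt (p # \<omega>)" by (simp add: uv i_def add.assoc)
    then show ?thesis using Cons.prems(1)[of "u @ v"] uv \<omega> by simp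
  next
    case 2
    then obtain \<omega>' where "\<omega>' \<in> words I" "length \<omega>' < length \<omega>" "elt \<omega>' = elt \<omega>"
      using Cons.IH[where a = "a + s i"] \<omega> by blast
    then show ?thesis using Cons.prems(1)[of "p # \<omega>'"] i by (simp add: i_def)
  qed
qed simp

text \<open>The exchange condition. If \<open>s\<^sub>i\<close> shortens \<open>elt \<omega>\<close>, then a geodesic to that element may start with
  \<open>s\<^sub>i\<close> and crosses the wall \<open>s\<^sub>i\<close> exactly once. By the parity invariant, \<open>\<omega>\<close> must cross it too.\<close>

lemma exchange:
  assumes "\<omega> \<in> words I" "i \<in> I" "len (s i + elt \<omega>) \<le> len (elt \<omega>)"
  obtains u p v where "\<omega> = u @ p # v" "s i + elt \<omega> = elt (u @ v)"
proof -
  have w: "elt \<omega> \<in> parabolic I" "s i + elt \<omega> \<in> parabolic I"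
    using assms by (auto intro: elt_parabolic add_parabolic s_parabolic)
  obtain v where v: "v \<in> words I" "length v = len (s i + elt \<omega>)" "elt v = s i + elt \<omega>"
    using w(2) by (rule geodesicE)
  define v' where "v' = (i, True) # v"
  have v': "v' \<in> words I" "elt v' = elt \<omega>" "length v' = len (elt \<omega>)"
    using len_s_add[OF assms(2) w(1)] assms v by (auto simp: v'_def)
  have "distinct (map fst (walls 0 v'))"
    using walls_not_distinct[OF v'(1)] len_elt_le v'(2,3) by (metis not_le)
  then have "count_list (map fst (walls 0 v')) (s i) = 1"
    by (auto simp: v'_def count_list_0_iff)
  moreover have "(v', \<omega>) \<in> cox_rel I" using v' assms(1) by (simp flip: elt_eq_iff)
  ultimately have "odd (count_list (map fst (walls 0 \<omega>)) (s i))"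
    using walls_parity[of v' \<omega> 0 "s i"] by simp
  then have "s i \<in> set (map fst (walls 0 \<omega>))"
    by (metis count_list_0_iff even_zero)
  then obtain e where "(s i, e) \<in> set (walls 0 \<omega>)" by auto
  then obtain u p v where \<omega>: "\<omega> = u @ p # v" and si: "s i = conjugate (0 + elt u) (s (fst p))"
    by (rule wallsE)
  from si have "elt u + s (fst p) = s i + elt u" by (metis add_0 conjugate_eq_conv)
  moreover have "s i + elt \<omega> = s i + elt u + (s (fst p) + elt v)" by (simp add: \<omega> add.assoc)
  ultimately have "s i + elt \<omega> = elt u + s (fst p) + (s (fst p) + elt v)" by simp
  also have "\<dots> = elt (u @ v)" using \<omega> assms(1) by (simp add: add.assoc)
  finally show ?thesis using that \<omega> by blast
qed

text \<open>The deletion condition: a word contains a geodesic.\<close>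

lemma geodesic_subword:
  assumes "\<omega> \<in> words I"
  obtains \<omega>' where "subseq \<omega>' \<omega>" "\<omega>' \<in> words I" "elt \<omega>' = elt \<omega>" "length \<omega>' = len (elt \<omega>)"
  using assms
proof (induction \<omega> arbitrary: thesis)
  case Nil
  then show ?case using Nil.prems(1)[of "[]"] by simp
next
  case (Cons p \<omega>)
  then obtain \<eta> where \<eta>: "subseq \<eta> \<omega>" "\<eta> \<in> words I" "elt \<eta> = elt \<omega>" "length \<eta> = len (elt \<omega>)"
    by auto
  have p: "fst p \<in> I" and w: "elt \<omega> \<in> parabolic I"
    using Cons.prems by (auto intro: elt_parabolic)
  from len_s_add[OF p w] show ?case
  proof
    assume "len (s (fst p) + elt \<omega>) = Suc (len (elt \<omega>))"
    then show ?thesis using Cons.prems(1)[of "p # \<eta>"] \<eta> p by simp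
  next
    assume less: "Suc (len (s (fst p) + elt \<omega>)) = len (elt \<omega>)"
    then have "len (s (fst p) + elt \<eta>) \<le> len (elt \<eta>)" using \<eta> by simp
    then obtain u q v where uv: "\<eta> = u @ q # v" "s (fst p) + elt \<eta> = elt (u @ v)"
      using exchange[OF \<eta>(2) p] by blast
    have "subseq (u @ v) \<eta>" unfolding uv(1) by (intro list_emb_append_mono list_emb_Cons) auto
    then have "subseq (u @ v) (p # \<omega>)"
      using \<eta>(1) by (meson subseq_order.order_trans list_emb_Cons)
    then show ?thesis using Cons.prems(1)[of "u @ v"] uv \<eta> less by simp
  qed
qed

lemma parabolic_geodesicE:
  assumes "X \<subseteq> I" "w \<in> parabolic X"
  obtains \<omega> where "\<omega> \<in> words X" "length \<omega> = len w" "elt \<omega> = w"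
proof -
  obtain \<eta> where \<eta>: "\<eta> \<in> words X" "elt \<eta> = w" using assms(2) by (rule parabolicE)
  then have "\<eta> \<in> words I" using words_mono[OF assms(1)] by auto
  then obtain \<omega> where "subseq \<omega> \<eta>" "elt \<omega> = elt \<eta>" "length \<omega> = len (elt \<eta>)"
    by (rule geodesic_subword)
  then show ?thesis using that words_subseq \<eta> by blast
qed

lemma parabolic_len_1:
  assumes "X \<subseteq> I" "w \<in> parabolic X" "len w = 1"
  obtains x where "x \<in> X" "w = s x"
proof -
  obtain \<omega> where "\<omega> \<in> words X" "length \<omega> = 1" "elt \<omega> = w"
    using parabolic_geodesicE[OF assms(1,2)] assms(3) by metis
  then show ?thesis using that by (auto simp: length_Suc_conv)
qed

text \<open>Only multiplication by single generators is tested. That such an element is the shortest one of its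
  coset \<open>W\<^sub>X b\<close>, with additive lengths, is \<open>min_rep_len_add\<close>.\<close>

definition min_rep :: "'i set \<Rightarrow> 'g \<Rightarrow> bool"
  where "min_rep X b \<longleftrightarrow> b \<in> parabolic I \<and> (\<forall>x\<in>X. len b < len (s x + b))"

text \<open>Concatenate geodesics \<open>p\<close> of \<open>a\<close> and \<open>q\<close> of \<open>b\<close>. A geodesic subword of \<open>pq\<close> must contain all
  of \<open>q\<close>, or else the coset would have an element shorter than \<open>b\<close>, and hence all of \<open>p\<close>.\<close>

lemma len_add_coset_minimum:
  assumes X: "X \<subseteq> I" and b: "b \<in> parabolic I"
    and min: "\<And>a. a \<in> parabolic X \<Longrightarrow> len b \<le> len (a + b)" and a: "a \<in> parabolic X"
  shows "len (a + b) = len a + len b"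
proof -
  obtain p where p: "p \<in> words X" "length p = len a" "elt p = a"
    using X a by (rule parabolic_geodesicE)
  obtain q where q: "q \<in> words I" "length q = len b" "elt q = b"
    using b by (rule geodesicE)
  have pI: "p \<in> words I" using p words_mono[OF X] by auto
  then obtain r where r: "subseq r (p @ q)" "elt r = elt (p @ q)" "length r = len (elt (p @ q))"
    using geodesic_subword[of "p @ q"] q by auto
  then obtain p' q' where pq: "r = p' @ q'" "subseq p' p" "subseq q' q"
    by (metis subseq_append_iff)
  have words: "p' \<in> words X" "p' \<in> words I" "q' \<in> words I"
    using words_subseq pq p pI q by auto
  have "elt p' + elt q' = a + b" using r pq p q by simp
  then have "elt q' = - elt p' + a + b" by (metis add.assoc minus_add_cancel)
  moreover have "- elt p' + a \<in> parabolic X"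
    using X a words by (intro add_parabolic uminus_parabolic elt_parabolic)
  ultimately have "len b \<le> len (elt q')" using min by simp
  then have "length q \<le> length q'" using len_elt_le[OF words(3)] q by simp
  then have "q' = q" using pq(3) subseq_same_length list_emb_length by (metis le_antisym)
  then have "elt p' = a" using \<open>elt p' + elt q' = a + b\<close> q by simp
  then have "length p \<le> length p'" using len_elt_le[OF words(2)] p by simp
  then show ?thesis
    using r pq \<open>q' = q\<close> p q list_emb_length[OF pq(2)] by simp
qed

lemma coset_minimumE:
  assumes X: "X \<subseteq> I" and w: "w \<in> parabolic I"
  obtains a b where "a \<in> parabolic X" "min_rep X b" "w = a + b"
    "\<And>c. c \<in> parabolic X \<Longrightarrow> len (c + b) = len c + len b"
proof -
  obtain c where c: "c \<in> parabolic X" "\<And>c'. c' \<in> parabolic X \<Longrightarrow> len (c + w) \<le> len (c' + w)"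
    using ex_has_least_nat[of "\<lambda>c. c \<in> parabolic X" 0 "\<lambda>c. len (c + w)"] by auto
  define b where "b = c + w"
  have b: "b \<in> parabolic I"
    using c w parabolic_mono[OF X] by (auto simp: b_def intro: add_parabolic)
  have add: "len (c' + b) = len c' + len b" if "c' \<in> parabolic X" for c'
    using X b _ that
  proof (rule len_add_coset_minimum)
    fix d assume "d \<in> parabolic X"
    then show "len b \<le> len (d + b)"
      using c(2)[of "d + c"] c(1) by (simp add: b_def add.assoc add_parabolic)
  qed
  have "min_rep X b" using b add[OF s_parabolic] X by (auto simp: min_rep_def)
  moreover have "w = - c + b" by (simp add: b_def)
  ultimately show ?thesis using that[of "- c" b] add uminus_parabolic[OF X c(1)] by blast
qed

text \<open>Compare \<open>b\<close> with an element \<open>b'\<close> of minimal length in its coset. If they differed, a geodesic of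
  their quotient in \<open>W\<^sub>X\<close> would start with a generator that shortens \<open>b\<close>.\<close>

lemma min_rep_len_add:
  assumes X: "X \<subseteq> I" and b: "min_rep X b" and a: "a \<in> parabolic X"
  shows "len (a + b) = len a + len b"
proof -
  have "b \<in> parabolic I" using b by (simp add: min_rep_def)
  with X obtain d b' where d: "d \<in> parabolic X" "min_rep X b'" "b = d + b'"
    "\<And>c. c \<in> parabolic X \<Longrightarrow> len (c + b') = len c + len b'"
    by (rule coset_minimumE) blast
  obtain \<omega> where \<omega>: "\<omega> \<in> words X" "length \<omega> = len d" "elt \<omega> = d"
    using X d(1) by (rule parabolic_geodesicE)
  have "\<omega> = []"
  proof (cases \<omega>)
    case (Cons p \<eta>)
    then have \<eta>: "\<eta> \<in> words X" "\<eta> \<in> words I" "fst p \<in> X" "fst p \<in> I"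
      using \<omega> words_mono[OF X] X by auto
    then have sd: "s (fst p) + d = elt \<eta>" using \<omega> Cons by auto
    then have "len (s (fst p) + b) = len (elt \<eta>) + len b'"
      using d(3) d(4)[of "elt \<eta>"] \<eta> by (simp add: elt_parabolic flip: add.assoc)
    also have "\<dots> < len d + len b'" using len_elt_le[OF \<eta>(2)] \<omega> Cons by simp
    also have "\<dots> = len b" using d by simp
    finally show ?thesis using b \<eta> by (force simp: min_rep_def)
  qed simp
  then have "b = b'" using d(3) \<omega> by simp
  then show ?thesis using d(4) a by simp
qed

lemma min_rep_unique:
  assumes X: "X \<subseteq> I" and "min_rep X b" "min_rep X b'" "a \<in> parabolic X" "b' = a + b"
  shows "b' = b"
proof -
  have "b = - a + b'" using assms by simp
  then have "len b = len (- a) + len b'"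
    using min_rep_len_add[OF X assms(3), of "- a"] uminus_parabolic[OF X assms(4)] by simp
  then have "len a = 0"
    using min_rep_len_add[OF X assms(2,4)] assms(5) by simp
  then show ?thesis
    using assms(4,5) parabolic_mono[OF X] len_eq_0_iff[of a] by auto
qed

lemma min_rep_0: "X \<subseteq> I \<Longrightarrow> min_rep X 0"
  by (auto simp: min_rep_def)

lemma min_rep_in: "min_rep X b \<Longrightarrow> b \<in> parabolic I"
  by (simp add: min_rep_def)

section \<open>The order of a product of two generators\<close>

text \<open>That \<open>s\<^sub>i s\<^sub>j\<close> has no smaller order than the presentation suggests is seen in the dual of the
  geometric representation, where \<open>s\<^sub>i\<close> maps \<open>f\<close> to \<open>f + f(i) c\<^sub>i\<close> for the row \<open>c\<^sub>i\<close> of the cosine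
  matrix. No relation constrains the entries at pairs that are not edges, so such pairs may be given any
  label \<open>M\<close>. Choosing \<open>M\<close> large shows that their order is infinite, with only rotations
  of finite order to analyse.\<close>

definition cosine_matrix :: "nat \<Rightarrow> 'i \<Rightarrow> 'i \<Rightarrow> real"
  where "cosine_matrix M i j = (if i = j then -2
    else 2 * cos (pi / real (if {i, j} \<in> edges \<Gamma> then label \<Gamma> {i, j} else M)))"

lemma cosine_matrix_sym: "cosine_matrix M j i = cosine_matrix M i j"
  by (simp add: cosine_matrix_def insert_commute)

definition act :: "nat \<Rightarrow> 'i \<Rightarrow> ('i \<Rightarrow> real) \<Rightarrow> 'i \<Rightarrow> real"
  where "act M i f = (\<lambda>k. f k + cosine_matrix M i k * f i)"

definition acts :: "nat \<Rightarrow> 'i word \<Rightarrow> ('i \<Rightarrow> real) \<Rightarrow> 'i \<Rightarrow> real"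
  where "acts M \<omega> = foldr (\<lambda>p. act M (fst p)) \<omega>"

lemma acts_Nil [simp]: "acts M [] f = f"
  and acts_Cons [simp]: "acts M (p # \<omega>) f = act M (fst p) (acts M \<omega> f)"
  and acts_append [simp]: "acts M (u @ v) f = acts M u (acts M v f)"
  by (simp_all add: acts_def)

lemma act_act [simp]: "act M i (act M i f) = f"
  by (auto simp: act_def cosine_matrix_def algebra_simps)

text \<open>In the plane of \<open>i\<close> and \<open>j\<close>, write \<open>f(i) = r sin \<phi>\<close> and \<open>f(j) = r sin (\<theta> - \<phi>)\<close>. Then \<open>s\<^sub>i\<close> and
  \<open>s\<^sub>j\<close> act on the angle as the reflections \<open>\<phi> \<mapsto> -\<phi>\<close> and \<open>\<phi> \<mapsto> 2\<theta> - \<phi>\<close>. This is the angle after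
  \<open>n\<close> alternating reflections, the last of which belongs to \<open>i\<close>; ending in \<open>j\<close> instead adds
  \<open>2n\<theta>\<close>.\<close>

primrec alt_angle :: "real \<Rightarrow> real \<Rightarrow> nat \<Rightarrow> real" where
  "alt_angle \<theta> \<phi> 0 = \<phi>"
| "alt_angle \<theta> \<phi> (Suc n) = - (alt_angle \<theta> \<phi> n + 2 * real n * \<theta>)"

lemma acts_alt:
  assumes ij: "i \<noteq> j" and c: "cosine_matrix M i j = 2 * cos \<theta>"
    and f: "f i = r * sin \<phi>" "f j = r * sin (\<theta> - \<phi>)"
  shows "acts M (alt i j n) f i = r * sin (alt_angle \<theta> \<phi> n)
    \<and> acts M (alt i j n) f j = r * sin (\<theta> - alt_angle \<theta> \<phi> n)
    \<and> acts M (alt j i n) f i = r * sin (alt_angle \<theta> \<phi> n + 2 * real n * \<theta>)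
    \<and> acts M (alt j i n) f j = r * sin (\<theta> - (alt_angle \<theta> \<phi> n + 2 * real n * \<theta>))"
proof (induction n)
  case 0
  then show ?case using f by simp
next
  case (Suc n)
  define A where "A = alt_angle \<theta> \<phi> n"
  define B where "B = A + 2 * real n * \<theta>"
  have c': "cosine_matrix M j i = 2 * cos \<theta>"
    using c by (simp add: cosine_matrix_sym)
  have cii: "cosine_matrix M k k = -2" for k by (simp add: cosine_matrix_def)
  have IH: "acts M (alt i j n) f i = r * sin A" "acts M (alt i j n) f j = r * sin (\<theta> - A)"
    "acts M (alt j i n) f i = r * sin B" "acts M (alt j i n) f j = r * sin (\<theta> - B)"
    using Suc by (simp_all only: A_def B_def)
  have [simp]: "sin (\<theta> - B) + 2 * cos \<theta> * sin B = sin (\<theta> + B)" for B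
    by (simp add: sin_add sin_diff algebra_simps)
  have "sin A + 2 * cos \<theta> * sin (\<theta> - A) = sin (\<theta> - (A - \<theta>))"
    using \<open>\<And>B. sin (\<theta> - B) + _ = _\<close>[of "\<theta> - A"] by simp
  moreover have "alt_angle \<theta> \<phi> (Suc n) + 2 * real (Suc n) * \<theta> = \<theta> - (A - \<theta>)"
    "alt_angle \<theta> \<phi> (Suc n) = - B"
    by (simp_all add: A_def B_def algebra_simps)
  moreover have "sin (\<theta> - (\<theta> - (A - \<theta>))) = - sin (\<theta> - A)"
    by (simp flip: sin_minus)
  moreover have "acts M (alt i j (Suc n)) f i = r * - sin B"
    "acts M (alt i j (Suc n)) f j = r * (sin (\<theta> - B) + 2 * cos \<theta> * sin B)"
    "acts M (alt j i (Suc n)) f i = r * (sin A + 2 * cos \<theta> * sin (\<theta> - A))"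
    "acts M (alt j i (Suc n)) f j = r * - sin (\<theta> - A)"
    using IH by (simp_all add: act_def c c' cii algebra_simps)
  ultimately show ?case by simp
qed

lemma alt_angle_surj: "\<exists>\<phi>. alt_angle \<theta> \<phi> n = \<psi>"
proof (induction n arbitrary: \<psi>)
  case (Suc n)
  from Suc[of "- \<psi> - 2 * real n * \<theta>"] obtain \<phi> where "alt_angle \<theta> \<phi> n = - \<psi> - 2 * real n * \<theta>" ..
  then show ?case by (intro exI[of _ \<phi>]) simp
qed simp

text \<open>As the plane of \<open>i\<close> and \<open>j\<close> is nondegenerate, \<open>f(k) + p f(i) + q f(j)\<close> is invariant for suitable
  \<open>p\<close> and \<open>q\<close>, so the other coordinates are controlled by those at \<open>i\<close> and \<open>j\<close>.\<close>

lemma acts_invariant: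
  assumes ij: "i \<noteq> j" and c: "cosine_matrix M i j = 2 * cos \<theta>" and \<theta>: "sin \<theta> \<noteq> 0"
  obtains p q where "\<And>\<omega> f. \<omega> \<in> words {i, j} \<Longrightarrow>
    acts M \<omega> f k + p * acts M \<omega> f i + q * acts M \<omega> f j = f k + p * f i + q * f j"
proof -
  define \<alpha> where "\<alpha> = cosine_matrix M i k"
  define \<beta> where "\<beta> = cosine_matrix M j k"
  define P where "P = (\<alpha> + cos \<theta> * \<beta>) / (sin \<theta>)\<^sup>2"
  define Q where "Q = (\<beta> + cos \<theta> * \<alpha>) / (sin \<theta>)\<^sup>2"
  define p where "p = P / 2"
  define q where "q = Q / 2"
  have c': "cosine_matrix M j i = 2 * cos \<theta>"
    using c by (simp add: cosine_matrix_sym)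
  have cii: "cosine_matrix M k k = -2" for k by (simp add: cosine_matrix_def)
  have eq: "a - (a + cos \<theta> * b) / (sin \<theta>)\<^sup>2 + cos \<theta> * ((b + cos \<theta> * a) / (sin \<theta>)\<^sup>2) = 0" for a b
  proof -
    have "a * (sin \<theta>)\<^sup>2 - (a + cos \<theta> * b) + cos \<theta> * (b + cos \<theta> * a) = 0"
      by (simp add: sin_squared_eq algebra_simps power2_eq_square[of "cos \<theta>"])
    moreover have "a - (a + cos \<theta> * b) / (sin \<theta>)\<^sup>2 + cos \<theta> * ((b + cos \<theta> * a) / (sin \<theta>)\<^sup>2) =
        (a * (sin \<theta>)\<^sup>2 - (a + cos \<theta> * b) + cos \<theta> * (b + cos \<theta> * a)) / (sin \<theta>)\<^sup>2"
      using \<theta> by (simp add: add_divide_distrib diff_divide_distrib distrib_left)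
    ultimately show ?thesis by simp
  qed
  have "\<alpha> - 2 * p + 2 * cos \<theta> * q = 0" "\<beta> - 2 * q + 2 * cos \<theta> * p = 0"
    using eq[of \<alpha> \<beta>] eq[of \<beta> \<alpha>] by (simp_all add: p_def q_def flip: P_def Q_def)
  then have \<alpha>\<beta>: "\<alpha> = 2 * p - 2 * cos \<theta> * q" "\<beta> = 2 * q - 2 * cos \<theta> * p" by simp_all
  have step: "act M l f k + p * act M l f i + q * act M l f j = f k + p * f i + q * f j"
    if "l = i \<or> l = j" for l f
    using that by (auto simp: act_def c c' cii \<alpha>_def[symmetric] \<beta>_def[symmetric] \<alpha>\<beta> algebra_simps)
  have "acts M \<omega> f k + p * acts M \<omega> f i + q * acts M \<omega> f j = f k + p * f i + q * f j"
    if "\<omega> \<in> words {i, j}" for \<omega> f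
    using that by (induction \<omega>) (auto simp: step)
  then show ?thesis using that by blast
qed

lemma acts_braid:
  assumes e: "{i, j} \<in> edges \<Gamma>"
  shows "acts M (alt i j (label \<Gamma> {i, j})) f = acts M (alt j i (label \<Gamma> {i, j})) f"
proof
  fix k
  define m where "m = label \<Gamma> {i, j}"
  define \<theta> where "\<theta> = pi / real m"
  have m: "m \<ge> 2" and ij: "i \<noteq> j" using edgeD[OF e] by (auto simp: m_def)
  have c: "cosine_matrix M i j = 2 * cos \<theta>"
    using e ij by (simp add: cosine_matrix_def \<theta>_def m_def)
  have "sin \<theta> > 0" using m by (intro sin_gt_zero) (auto simp: \<theta>_def field_simps)
  then have \<theta>: "sin \<theta> \<noteq> 0" by simp
  obtain r \<phi> where "(f j + f i * cos \<theta>) / sin \<theta> = r * cos \<phi>" "f i = r * sin \<phi>"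
    using polar_Ex by blast
  then have f: "f i = r * sin \<phi>" "f j = r * sin (\<theta> - \<phi>)"
    using \<theta> by (simp_all add: sin_diff field_simps)
  have turn: "2 * real m * \<theta> = 2 * pi" using m by (simp add: \<theta>_def)
  have "sin (\<theta> - (x + 2 * pi)) = sin (\<theta> - x)" for x
    using sin_periodic[of "\<theta> - x - 2 * pi"] by (simp add: algebra_simps)
  then have eq: "acts M (alt i j m) f i = acts M (alt j i m) f i"
    "acts M (alt i j m) f j = acts M (alt j i m) f j"
    using acts_alt[OF ij c f, of m] by (simp_all add: turn)
  obtain p q where "\<And>\<omega> f. \<omega> \<in> words {i, j} \<Longrightarrow>
      acts M \<omega> f k + p * acts M \<omega> f i + q * acts M \<omega> f j = f k + p * f i + q * f j"
    using acts_invariant[OF ij c \<theta>] by blast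
  from this[of "alt i j m" f] this[of "alt j i m" f]
  show "acts M (alt i j (label \<Gamma> {i, j})) f k = acts M (alt j i (label \<Gamma> {i, j})) f k"
    using eq by (simp add: alternating_words del: pos_word_simps flip: m_def)
qed

lemma acts_cong:
  assumes "(u, v) \<in> cox_rel I"
  shows "acts M u = acts M v"
  using assms
proof (induction rule: pres_rel.induct)
  case (relator u v l r)
  then have "acts M l = acts M r"
    by (auto simp: fun_eq_iff[of "acts M _"] coxeter_relators_def braid_relators_iff intro: acts_braid)
  then show ?case by auto
qed auto

text \<open>The starting angle is chosen such that the two words take it to \<open>\<mp>n\<theta>\<close>, which the coordinate at
  \<open>i\<close> tells apart as long as \<open>0 < n\<theta> < \<pi>\<close>.\<close>

lemma elt_alt_eqD:
  assumes "i \<in> I" "j \<in> I" "i \<noteq> j" "n > 0" "elt (alt i j n) = elt (alt j i n)"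
  shows "{i, j} \<in> edges \<Gamma>" "label \<Gamma> {i, j} \<le> n"
proof -
  define m where "m = (if {i, j} \<in> edges \<Gamma> then label \<Gamma> {i, j} else Suc n)"
  define \<theta> where "\<theta> = pi / real m"
  have c: "cosine_matrix (Suc n) i j = 2 * cos \<theta>"
    using assms(3) by (simp add: cosine_matrix_def \<theta>_def m_def)
  have "m \<le> n"
  proof (rule ccontr)
    assume n: "\<not> m \<le> n"
    obtain \<phi> where \<phi>: "alt_angle \<theta> \<phi> n = - (real n * \<theta>)" using alt_angle_surj by blast
    define f where "f = (\<lambda>k. if k = i then sin \<phi> else sin (\<theta> - \<phi>))"
    have "(alt i j n, alt j i n) \<in> cox_rel I"
      using assms by (simp add: alternating_words del: pos_word_simps flip: elt_eq_iff)
    then have "acts (Suc n) (alt i j n) f i = acts (Suc n) (alt j i n) f i"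
      by (simp add: acts_cong)
    moreover have "f i = 1 * sin \<phi>" "f j = 1 * sin (\<theta> - \<phi>)"
      using assms(3) by (simp_all add: f_def)
    from acts_alt[OF assms(3) c this, of n]
    have "acts (Suc n) (alt i j n) f i = sin (- (real n * \<theta>))"
      "acts (Suc n) (alt j i n) f i = sin (- (real n * \<theta>) + 2 * real n * \<theta>)"
      by (simp_all only: \<phi> mult_1)
    moreover have "- (real n * \<theta>) + 2 * real n * \<theta> = real n * \<theta>" by simp
    ultimately have "sin (- (real n * \<theta>)) = sin (real n * \<theta>)" by (simp only:)
    then have "sin (real n * \<theta>) = 0" by simp
    moreover have "sin (real n * \<theta>) > 0"
      using n assms(4) by (intro sin_gt_zero) (auto simp: \<theta>_def field_simps)
    ultimately show False by simp
  qed
  then show "{i, j} \<in> edges \<Gamma>" "label \<Gamma> {i, j} \<le> n" by (auto simp: m_def split: if_splits)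
qed

lemma s_inj: "i \<in> I \<Longrightarrow> j \<in> I \<Longrightarrow> s i = s j \<longleftrightarrow> i = j"
  using elt_alt_eqD[of i j 1] edgeD(4)[of i j] by fastforce

section \<open>Intersections of standard parabolic subgroups\<close>

text \<open>The first letter of a geodesic of \<open>w \<in> W\<^sub>Y\<close> shortens \<open>w\<close>. Exchanging it in a word over \<open>Y\<close> shows that
  the shorter element lies in \<open>W\<^sub>Y\<close>, and hence so does the letter. Thus all geodesics of \<open>w\<close> have the
  same support.\<close>

lemma geodesic_in_parabolic:
  assumes Y: "Y \<subseteq> I" and "\<omega> \<in> words I" "length \<omega> = len (elt \<omega>)" "elt \<omega> \<in> parabolic Y"
  shows "\<omega> \<in> words Y"
  using assms(2-4)
proof (induction \<omega>)
  case (Cons p \<omega>)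
  have p: "fst p \<in> I" and \<omega>: "\<omega> \<in> words I" using Cons.prems by auto
  have short: "s (fst p) + elt (p # \<omega>) = elt \<omega>" using p by simp
  obtain \<eta> where \<eta>: "\<eta> \<in> words Y" "elt \<eta> = elt (p # \<omega>)"
    using Cons.prems(3) by (rule parabolicE)
  have \<eta>I: "\<eta> \<in> words I" using \<eta> words_mono[OF Y] by auto
  have "len (elt \<omega>) \<le> length \<omega>" using \<omega> by (rule len_elt_le)
  also have "\<dots> < len (elt \<eta>)" using Cons.prems(2) \<eta> by simp
  finally have "len (s (fst p) + elt \<eta>) \<le> len (elt \<eta>)" using short \<eta> by simp
  then obtain u q v where uv: "\<eta> = u @ q # v" "s (fst p) + elt \<eta> = elt (u @ v)"
    using exchange[OF \<eta>I p] by blast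
  have \<omega>Y: "elt \<omega> \<in> parabolic Y"
    using uv \<eta> short by (metis elt_parabolic words_Cons' words_append)
  have "length \<omega> \<le> len (elt \<omega>)"
    using len_s_add[OF p elt_parabolic[OF \<omega>]] Cons.prems(2) by auto
  then have "\<omega> \<in> words Y" using Cons.IH \<omega> \<omega>Y len_elt_le[OF \<omega>] by simp
  moreover have "s (fst p) = elt (p # \<omega>) - elt \<omega>" by simp
  then have "s (fst p) \<in> parabolic Y" using diff_parabolic[OF Y Cons.prems(3) \<omega>Y] by metis
  then obtain y where "y \<in> Y" "s (fst p) = s y" using parabolic_len_1[OF Y] p by (metis len_s)
  then have "fst p \<in> Y" using s_inj p Y by auto
  ultimately show ?case by simp
qed simp

lemma parabolic_Int:
  assumes "X \<subseteq> I" "Y \<subseteq> I"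
  shows "parabolic X \<inter> parabolic Y = parabolic (X \<inter> Y)"
proof
  show "parabolic X \<inter> parabolic Y \<subseteq> parabolic (X \<inter> Y)"
  proof
    fix w assume w: "w \<in> parabolic X \<inter> parabolic Y"
    then obtain \<omega> where \<omega>: "\<omega> \<in> words X" "length \<omega> = len w" "elt \<omega> = w"
      using parabolic_geodesicE[OF assms(1)] by blast
    then have "\<omega> \<in> words Y"
      using geodesic_in_parabolic[OF assms(2)] words_mono[OF assms(1)] w by auto
    then have "\<omega> \<in> words (X \<inter> Y)" using \<omega> by (auto simp: words_def)
    then show "w \<in> parabolic (X \<inter> Y)" using \<omega> elt_parabolic by blast
  qed
qed (auto dest: subsetD[OF parabolic_mono, rotated])

section \<open>The retraction on words\<close>

text \<open>The retraction follows a word \<open>\<omega>\<close> through the minimal representatives \<open>b\<close> of the cosets of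
  \<open>W\<^sub>X\<close>. A letter that moves \<open>b\<close> to another representative is dropped; a letter that fixes the coset
  of \<open>b\<close> is replaced by the letter of \<open>X\<close> to which \<open>b\<close> conjugates it.\<close>

definition fixing_letter :: "'i set \<Rightarrow> 'g \<Rightarrow> 'i \<Rightarrow> 'i option"
  where "fixing_letter X b i =
    (if \<exists>x\<in>X. conjugate b (s i) = s x then Some (THE x. x \<in> X \<and> conjugate b (s i) = s x) else None)"

primrec retract :: "'i set \<Rightarrow> 'g \<Rightarrow> 'i word \<Rightarrow> 'i word" where
  "retract X b [] = []"
| "retract X b (p # \<omega>) = (case fixing_letter X b (fst p) of
      None \<Rightarrow> retract X (b + s (fst p)) \<omega>
    | Some x \<Rightarrow> (x, snd p) # retract X b \<omega>)"

primrec final_rep :: "'i set \<Rightarrow> 'g \<Rightarrow> 'i word \<Rightarrow> 'g" where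
  "final_rep X b [] = b"
| "final_rep X b (p # \<omega>) = (case fixing_letter X b (fst p) of
      None \<Rightarrow> final_rep X (b + s (fst p)) \<omega>
    | Some x \<Rightarrow> final_rep X b \<omega>)"

lemma fixing_letter_eq_Some_iff:
  assumes "X \<subseteq> I"
  shows "fixing_letter X b i = Some x \<longleftrightarrow> x \<in> X \<and> conjugate b (s i) = s x"
proof -
  have uniq: "y = z" if "y \<in> X" "z \<in> X" "conjugate b (s i) = s y" "conjugate b (s i) = s z" for y z
    using that assms s_inj[of y z] by auto
  then have the: "(THE x. x \<in> X \<and> conjugate b (s i) = s x) = y"
    if "y \<in> X" "conjugate b (s i) = s y" for y
    using that by (intro the_equality) auto
  show ?thesis
  proof (cases "\<exists>x\<in>X. conjugate b (s i) = s x")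
    case True
    then obtain y where y: "y \<in> X" "conjugate b (s i) = s y" by blast
    then have "fixing_letter X b i = Some y" unfolding fixing_letter_def using the by auto
    then show ?thesis using uniq y by auto
  qed (auto simp: fixing_letter_def)
qed

lemma fixing_letter_eq_None_iff:
  "fixing_letter X b i = None \<longleftrightarrow> (\<forall>x\<in>X. conjugate b (s i) \<noteq> s x)"
  by (auto simp: fixing_letter_def)

lemma retract_append:
  "retract X b (u @ v) = retract X b u @ retract X (final_rep X b u) v"
  by (induction u arbitrary: b) (auto split: option.splits)

text \<open>Suppose that \<open>s\<^sub>x\<close> shortens \<open>b s\<^sub>i\<close>. It does not shorten \<open>b\<close>, so by the exchange condition the
  letter that it removes from a geodesic of \<open>b\<close> followed by \<open>s\<^sub>i\<close> is the last one: \<open>s\<^sub>x b s\<^sub>i = b\<close>.\<close>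

lemma min_rep_step:
  assumes X: "X \<subseteq> I" and b: "min_rep X b" and i: "i \<in> I" and none: "fixing_letter X b i = None"
  shows "min_rep X (b + s i)"
proof (rule ccontr)
  assume "\<not> min_rep X (b + s i)"
  moreover have bi: "b + s i \<in> parabolic I"
    using b i by (auto simp: min_rep_def intro: add_parabolic s_parabolic)
  ultimately obtain x where x: "x \<in> X" "len (s x + (b + s i)) \<le> len (b + s i)"
    by (auto simp: min_rep_def not_less)
  obtain \<omega> where \<omega>: "\<omega> \<in> words I" "length \<omega> = len b" "elt \<omega> = b"
    using min_rep_in[OF b] by (rule geodesicE)
  have xI: "x \<in> I" using x X by auto
  have le: "len (s x + elt (\<omega> @ [(i, True)])) \<le> len (elt (\<omega> @ [(i, True)]))" using x \<omega> by simp
  have "\<omega> @ [(i, True)] \<in> words I" using \<omega> i by simp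
  then obtain u p v where uv: "\<omega> @ [(i, True)] = u @ p # v"
      "s x + elt (\<omega> @ [(i, True)]) = elt (u @ v)"
    using xI le by (rule exchange)
  show False
  proof (cases v rule: rev_cases)
    case Nil
    then have "s x + (b + s i) = b" using uv \<omega> by (cases p) simp
    then have "b + s i = s x + b" using xI by (metis s_cancel)
    then have "conjugate b (s i) = s x" by (simp add: conjugate_eq_conv)
    then show False using none x by (auto simp: fixing_letter_eq_None_iff)
  next
    case (snoc v' q)
    then have v: "\<omega> = u @ p # v'" "q = (i, True)" using uv by auto
    have "s x + b + s i = elt (u @ v') + s i" using uv(2) snoc v(2) \<omega>(3) by (simp add: add.assoc)
    then have "s x + b = elt (u @ v')" by simp
    then have "len (s x + b) \<le> length (u @ v')" using len_elt_le[of "u @ v'"] v \<omega> by simp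
    then have "len (s x + b) < len b" using v \<omega> by simp
    then show False using b x by (force simp: min_rep_def)
  qed
qed

text \<open>If \<open>r = b s\<^sub>i b\<inverse>\<close> lies in \<open>W\<^sub>X\<close>, then \<open>r b = b s\<^sub>i\<close> is at most one longer than \<open>b\<close>, so \<open>r\<close> has length
  1. Hence the letters that are kept are exactly those that cross a wall of \<open>W\<^sub>X\<close>.\<close>

lemma conjugate_in_parabolic:
  assumes X: "X \<subseteq> I" and b: "min_rep X b" and i: "i \<in> I"
    and "conjugate b (s i) \<in> parabolic X"
  obtains x where "x \<in> X" "conjugate b (s i) = s x"
proof -
  define r where "r = conjugate b (s i)"
  have r: "r \<in> parabolic X" "r + b = b + s i" using assms(4) by (simp_all add: r_def conjugate_def)
  have "len (b + s i) \<le> len b + 1"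
    using len_add_le[of b "s i"] min_rep_in[OF b] s_parabolic[OF i] i by simp
  then have "len r \<le> 1" using min_rep_len_add[OF X b r(1)] r(2) by simp
  moreover have "r \<noteq> 0"
    using s_neq_0[OF i] add_left_cancel[of b "s i" 0] by (simp add: r_def conjugate_eq_conv)
  then have "len r \<noteq> 0" using len_eq_0_iff r parabolic_mono[OF X] by auto
  ultimately have "len r = 1" by simp
  then show ?thesis using parabolic_len_1[OF X r(1)] that by (auto simp: r_def)
qed

lemma final_rep_min_rep:
  assumes X: "X \<subseteq> I" and "min_rep X b" "\<omega> \<in> words I"
  shows "min_rep X (final_rep X b \<omega>)"
  using assms(2,3) by (induction \<omega> arbitrary: b) (auto simp: min_rep_step[OF X] split: option.split)

lemma retract_words:
  assumes X: "X \<subseteq> I"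
  shows "retract X b \<omega> \<in> words X"
  by (induction \<omega> arbitrary: b) (auto simp: fixing_letter_eq_Some_iff[OF X] split: option.split)

lemma elt_retract:
  assumes X: "X \<subseteq> I"
  shows "b + elt \<omega> = elt (retract X b \<omega>) + final_rep X b \<omega>"
proof (induction \<omega> arbitrary: b)
  case (Cons p \<omega>)
  show ?case
  proof (cases "fixing_letter X b (fst p)")
    case None
    then show ?thesis using Cons[of "b + s (fst p)"] by (simp add: add.assoc)
  next
    case (Some x)
    then have "b + s (fst p) = s x + b"
      by (simp add: fixing_letter_eq_Some_iff[OF X] conjugate_eq_conv)
    then have "b + elt (p # \<omega>) = s x + (b + elt \<omega>)" by (simp flip: add.assoc)
    then show ?thesis using Some Cons[of b] by (simp add: add.assoc)
  qed
qed simp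

text \<open>The walls of \<open>W\<^sub>X\<close> that a word crosses are those of its retraction, in the same order and with
  the same signs. As a word is determined by its walls, this determines the retraction without mention
  of coset representatives, and the compatibility of the retractions for different \<open>X\<close> reduces
  to \<open>W\<^sub>X \<inter> W\<^sub>Y = W\<^sub>X\<^sub>\<inter>\<^sub>Y\<close>.\<close>

lemma walls_retract:
  assumes X: "X \<subseteq> I" and "min_rep X b" "\<omega> \<in> words I"
  shows "walls 0 (retract X b \<omega>) = filter (\<lambda>(t, e). t \<in> parabolic X) (walls b \<omega>)"
  using assms(2,3)
proof (induction \<omega> arbitrary: b)
  case (Cons p \<omega>)
  have p: "fst p \<in> I" and \<omega>: "\<omega> \<in> words I" using Cons.prems by auto
  show ?case
  proof (cases "fixing_letter X b (fst p)")
    case None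
    then have "conjugate b (s (fst p)) \<notin> parabolic X"
      using conjugate_in_parabolic[OF X Cons.prems(1) p] by (metis fixing_letter_eq_None_iff)
    then show ?thesis
      using None Cons.IH[OF min_rep_step[OF X Cons.prems(1) p None] \<omega>] by simp
  next
    case (Some x)
    then have x: "x \<in> X" "conjugate b (s (fst p)) = s x" "b + s (fst p) = s x + b"
      by (simp_all add: fixing_letter_eq_Some_iff[OF X] conjugate_eq_conv)
    have sx: "s x \<in> parabolic X" using x by (simp add: s_parabolic)
    have "walls 0 (retract X b (p # \<omega>)) =
        (s x, snd p) # map (apfst (conjugate (s x))) (walls 0 (retract X b \<omega>))"
      using Some walls_add[of "s x" 0] by simp
    also have "walls 0 (retract X b \<omega>) = filter (\<lambda>(t, e). t \<in> parabolic X) (walls b \<omega>)"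
      using Cons.IH[OF Cons.prems(1) \<omega>] .
    also have "map (apfst (conjugate (s x))) \<dots> =
        filter (\<lambda>(t, e). t \<in> parabolic X) (map (apfst (conjugate (s x))) (walls b \<omega>))"
      by (induction "walls b \<omega>") (auto simp: filter_map comp_def case_prod_beta conjugate_parabolic_iff[OF X sx])
    also have "map (apfst (conjugate (s x))) (walls b \<omega>) = walls (s x + b) \<omega>"
      by (simp add: walls_add)
    finally show ?thesis using x sx by simp
  qed
qed simp

lemma walls_inj:
  assumes "u \<in> words I" "v \<in> words I" "walls a u = walls a v"
  shows "u = v"
  using assms
proof (induction u arbitrary: v a)
  case (Cons p u)
  then obtain q v' where v: "v = q # v'" by (cases v) auto
  with Cons.prems have "p = q" by (auto simp: prod_eq_iff s_inj)
  then show ?case using Cons v by auto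
qed (metis length_0_conv length_walls)

lemma walls_in_parabolic:
  assumes "Y \<subseteq> I" "a \<in> parabolic Y" "\<omega> \<in> words Y" "(t, e) \<in> set (walls a \<omega>)"
  shows "t \<in> parabolic Y"
  using assms(4)
proof (rule wallsE)
  fix u p v assume "\<omega> = u @ p # v" and t: "t = conjugate (a + elt u) (s (fst p))"
  then have "a + elt u \<in> parabolic Y" "s (fst p) \<in> parabolic Y"
    using assms by (auto intro!: add_parabolic elt_parabolic s_parabolic)
  then show ?thesis using t conjugate_parabolic_iff[OF assms(1)] by simp
qed

lemma retract_id:
  assumes X: "X \<subseteq> I" and \<omega>: "\<omega> \<in> words X"
  shows "retract X 0 \<omega> = \<omega>"
proof (rule walls_inj)
  have \<omega>I: "\<omega> \<in> words I" using \<omega> words_mono[OF X] by auto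
  show "walls 0 (retract X 0 \<omega>) = walls 0 \<omega>"
    unfolding walls_retract[OF X min_rep_0[OF X] \<omega>I]
    using walls_in_parabolic[OF X zero_parabolic \<omega>] by (auto simp: filter_id_conv)
  show "\<omega> \<in> words I" using \<omega>I .
  show "retract X 0 \<omega> \<in> words I" using retract_words[OF X] words_mono[OF X] by blast
qed

lemma final_rep_id:
  assumes X: "X \<subseteq> I" and \<omega>: "\<omega> \<in> words X"
  shows "final_rep X 0 \<omega> = 0"
  using elt_retract[OF X, of 0 \<omega>] retract_id[OF assms] by (metis add_0 add_0_right add_left_cancel)

lemma length_retract: "length (retract X b \<omega>) \<le> length \<omega>"
  by (induction \<omega> arbitrary: b) (auto intro: le_SucI split: option.split)

lemma length_retract_eqD:
  assumes X: "X \<subseteq> I"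
  shows "\<omega> \<in> words I \<Longrightarrow> length (retract X 0 \<omega>) = length \<omega> \<Longrightarrow> \<omega> \<in> words X"
proof (induction \<omega>)
  case (Cons p \<omega>)
  show ?case
  proof (cases "fixing_letter X 0 (fst p)")
    case None
    then show ?thesis using Cons.prems length_retract[of X "0 + s (fst p)" \<omega>] by simp
  next
    case (Some x)
    then have "x = fst p" "x \<in> X"
      using X Cons.prems s_inj[of "fst p" x] by (auto simp: fixing_letter_eq_Some_iff[OF X])
    then show ?thesis using Cons Some by auto
  qed
qed simp

lemma retract_retract:
  assumes "X \<subseteq> I" "Y \<subseteq> I" "\<omega> \<in> words I"
  shows "retract Y 0 (retract X 0 \<omega>) = retract (X \<inter> Y) 0 \<omega>"
proof (rule walls_inj)
  have XY: "X \<inter> Y \<subseteq> I" using assms by auto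
  have X\<omega>: "retract X 0 \<omega> \<in> words I" using retract_words[OF assms(1)] words_mono[OF assms(1)] by blast
  show "retract Y 0 (retract X 0 \<omega>) \<in> words I" "retract (X \<inter> Y) 0 \<omega> \<in> words I"
    using retract_words[OF assms(2)] words_mono[OF assms(2)] retract_words[OF XY] words_mono[OF XY]
    by blast+
  have "t \<in> parabolic (X \<inter> Y) \<longleftrightarrow> t \<in> parabolic X \<and> t \<in> parabolic Y" for t
    using parabolic_Int[OF assms(1,2)] by auto
  then show "walls 0 (retract Y 0 (retract X 0 \<omega>)) = walls 0 (retract (X \<inter> Y) 0 \<omega>)"
    using assms XY X\<omega> by (simp add: walls_retract min_rep_0 case_prod_unfold)
qed

lemma retract_words_Int:
  assumes "X \<subseteq> I" "Y \<subseteq> I" "\<omega> \<in> words Y"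
  shows "retract X 0 \<omega> = retract (Y \<inter> X) 0 \<omega>"
  using retract_retract[OF assms(2,1), of \<omega>] retract_id[OF assms(2,3)] words_mono[OF assms(2)] assms(3)
  by auto

section \<open>The retraction respects the relations\<close>

lemma final_rep_eq:
  assumes X: "X \<subseteq> I" and b: "min_rep X b" and uv: "u \<in> words I" "v \<in> words I" "elt u = elt v"
  shows "final_rep X b u = final_rep X b v"
proof (rule min_rep_unique[OF X final_rep_min_rep[OF X b uv(2)] final_rep_min_rep[OF X b uv(1)]])
  have "elt (retract X b u) + final_rep X b u = elt (retract X b v) + final_rep X b v"
    using elt_retract[OF X, of b] uv(3) by metis
  then show "final_rep X b u = - elt (retract X b u) + elt (retract X b v) + final_rep X b v"
    by (metis add.assoc minus_add_cancel)
  show "- elt (retract X b u) + elt (retract X b v) \<in> parabolic X"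
    using X retract_words[OF X] by (intro add_parabolic uminus_parabolic elt_parabolic)
qed

lemma fixing_letter_add_s [simp]: "i \<in> I \<Longrightarrow> fixing_letter X (b + s i) i = fixing_letter X b i"
  by (simp add: fixing_letter_def)

text \<open>It suffices to check the defining relators, from every coset representative at which they may
  be read. A cancelling pair either is kept as such a pair or steps to a neighbouring representative and
  back.\<close>

lemma retract_respects:
  assumes X: "X \<subseteq> I" and Z: "Z \<subseteq> I" and uv: "(u, v) \<in> pres_rel Z R" and b: "min_rep X b"
    and R: "\<And>l r b. (l, r) \<in> R \<Longrightarrow> l \<in> words Z \<Longrightarrow> r \<in> words Z \<Longrightarrow> min_rep X b \<Longrightarrow>
      (retract X b l, retract X b r) \<in> pres_rel X R' \<and> elt l = elt r"
  shows "(retract X b u, retract X b v) \<in> pres_rel X R'"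
  using uv b
proof (induction arbitrary: b rule: pres_rel.induct)
  case (refl u)
  show ?case using retract_words[OF X] by (rule pres_rel.refl)
next
  case (cancel u v a e)
  define c where "c = final_rep X b u"
  have a: "a \<in> I" using cancel Z by auto
  show ?case
  proof (cases "fixing_letter X c a")
    case None
    then have "retract X b (u @ [(a, e), (a, \<not> e)] @ v) = retract X b (u @ v)"
      using a by (simp add: retract_append flip: c_def)
    then show ?thesis using retract_words[OF X] by (auto intro: pres_rel.refl)
  next
    case (Some x)
    then have "retract X b (u @ [(a, e), (a, \<not> e)] @ v) =
        retract X b u @ [(x, e), (x, \<not> e)] @ retract X c v"
      by (simp add: retract_append flip: c_def)
    moreover have "x \<in> X" using Some by (simp add: fixing_letter_eq_Some_iff[OF X])
    ultimately show ?thesis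
      using pres_rel.cancel[where b = e, OF retract_words[OF X, of b u] retract_words[OF X, of c v]]
      by (simp add: retract_append flip: c_def)
  qed
next
  case (relator u v l r)
  define c where "c = final_rep X b u"
  have words: "u \<in> words I" "l \<in> words I" "r \<in> words I" using relator words_mono[OF Z] by auto
  have c: "min_rep X c" unfolding c_def using X relator.prems words(1) by (rule final_rep_min_rep)
  have lr: "(retract X c l, retract X c r) \<in> pres_rel X R'" "elt l = elt r"
    using R relator c by auto
  have "final_rep X c l = final_rep X c r" using X c words(2,3) lr(2) by (rule final_rep_eq)
  then show ?case
    using pres_rel_context[OF lr(1) retract_words[OF X] retract_words[OF X], of b u "final_rep X c r" v]
    by (simp add: retract_append flip: c_def)
qed (auto intro: pres_rel.sym pres_rel.trans)

lemma snd_retract: "snd ` set (retract X b \<omega>) \<subseteq> snd ` set \<omega>"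
  by (induction \<omega> arbitrary: b) (auto split: option.splits)

lemma snd_pos_word: "snd ` set (pos_word xs) \<subseteq> {True}"
  by (auto simp: pos_word_def)

lemma conjugate_uminus: "conjugate (- a) t = t' \<longleftrightarrow> t = conjugate a t'"
  by (metis add.inverse_inverse conjugate_0 conjugate_add left_minus right_minus)

text \<open>The retraction of a word over \<open>J\<close> can be controlled from the shortest element \<open>c\<close> of the
  coset \<open>c W\<^sub>J\<close> in which it runs. If a letter is kept at \<open>c d\<close> and becomes \<open>x\<close>, then \<open>c\<inverse> s\<^sub>x c\<close> lies in
  \<open>W\<^sub>J\<close>, so \<open>c\<inverse>\<close> conjugates \<open>s\<^sub>x\<close> to a generator of \<open>W\<^sub>J\<close>. The inverse appears because \<open>min_rep\<close> refers
  to cosets of the form \<open>W\<^sub>J c\<inverse>\<close>.\<close>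

lemma letters_kept_at_coset_minimum:
  assumes X: "X \<subseteq> I" and J: "J \<subseteq> I" and c: "min_rep J (- c)"
    and "d \<in> parabolic J" "\<omega> \<in> words J" "p \<in> set (retract X (c + d) \<omega>)"
  shows "\<exists>k\<in>J. fixing_letter X c k = Some (fst p)"
  using assms(4-6)
proof (induction \<omega> arbitrary: d)
  case (Cons q \<omega>)
  then have q: "fst q \<in> J" and \<omega>: "\<omega> \<in> words J" by auto
  have IH: "\<exists>k\<in>J. fixing_letter X c k = Some (fst p)"
    if "p \<in> set (retract X (c + d') \<omega>)" "d' \<in> parabolic J" for d'
    using Cons.IH that \<omega> by blast
  show ?case
  proof (cases "fixing_letter X (c + d) (fst q)")
    case None
    then have "p \<in> set (retract X (c + (d + s (fst q))) \<omega>)"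
      using Cons.prems(3) by (simp add: add.assoc)
    then show ?thesis using IH Cons.prems(1) q by (metis add_parabolic s_parabolic)
  next
    case (Some x)
    then consider "p = (x, snd q)" | "p \<in> set (retract X (c + d) \<omega>)"
      using Cons.prems(3) by auto
    then show ?thesis
    proof cases
      case 1
      have x: "x \<in> X" "conjugate c (conjugate d (s (fst q))) = s x"
        using Some by (simp_all add: fixing_letter_eq_Some_iff[OF X] conjugate_add)
      then have "conjugate (- c) (s x) = conjugate d (s (fst q))"
        by (simp add: conjugate_uminus)
      also have "\<dots> \<in> parabolic J"
        using Cons.prems(1) q J by (simp add: conjugate_parabolic_iff s_parabolic)
      finally obtain k where "k \<in> J" "conjugate (- c) (s x) = s k"
        using conjugate_in_parabolic[OF J c, of x] x X by auto
      then show ?thesis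
        using 1 x by (auto simp: conjugate_uminus fixing_letter_eq_Some_iff[OF X])
    qed (use IH Cons.prems(1) in blast)
  qed
qed simp

lemma retract_alt_fixed:
  assumes "fixing_letter X c i = Some x" "fixing_letter X c j = Some y"
  shows "retract X c (alt i j n) = alt x y n" "final_rep X c (alt i j n) = c"
  using assms by (induction n arbitrary: i j x y) auto

text \<open>If both letters are kept at \<open>c\<close>, then \<open>b = c\<close>, and conjugation by \<open>c\<close> maps \<open>s\<^sub>i s\<^sub>j\<close> to
  \<open>s\<^sub>x s\<^sub>y\<close> of the same order, so the braid relation of \<open>i\<close> and \<open>j\<close> becomes that of \<open>x\<close> and \<open>y\<close>.
  Otherwise only one letter \<open>x\<close> can occur in the retractions of the two sides. These are
  equal then, because both sides cross the same number of walls of \<open>W\<^sub>X\<close>.\<close>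

lemma retract_braid:
  assumes X: "X \<subseteq> I" and b: "min_rep X b" and e: "{i, j} \<in> edges \<Gamma>"
  defines "m \<equiv> label \<Gamma> {i, j}"
  shows "(retract X b (alt i j m), retract X b (alt j i m)) \<in> art_rel X"
proof -
  define J where "J = {i, j}"
  have ij: "i \<in> I" "j \<in> I" "i \<noteq> j" "m \<ge> 2" and J: "J \<subseteq> I"
    using edgeD[OF e] by (auto simp: m_def J_def)
  have bI: "b \<in> parabolic I" using b by (rule min_rep_in)
  then obtain a c' where a: "a \<in> parabolic J" "min_rep J c'" "- b = a + c'"
    using coset_minimumE[OF J, of "- b"] uminus_parabolic[OF order_refl bI] by metis
  \<comment> \<open>The shortest element \<open>c\<close> of \<open>b W\<^sub>J\<close> is the inverse of the one of \<open>W\<^sub>J b\<inverse>\<close>.\<close>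
  define c d where "c = - c'" and "d = - a"
  have d: "d \<in> parabolic J" using a J by (simp add: d_def uminus_parabolic)
  have "b = - (a + c')" using a(3) by (metis add.inverse_inverse)
  then have bcd: "b = c + d" by (simp add: minus_add c_def d_def del: add_uminus_conv_diff)
  have cI: "c \<in> parabolic I" and dI: "d \<in> parabolic I"
    using min_rep_in[OF a(2)] d parabolic_mono[OF J] by (auto simp: c_def uminus_parabolic)
  have len_b: "len b = len c + len d"
    using min_rep_len_add[OF J a(2,1)] len_uminus[OF bI] a(3) len_uminus[of "a"] len_uminus[of c']
      min_rep_in[OF a(2)] a(1) parabolic_mono[OF J] by (auto simp: c_def d_def)
  \<comment> \<open>A generator shortening \<open>c\<close> would also shorten \<open>b = c d\<close>, as lengths add up here.\<close>
  have c: "min_rep X c"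
    unfolding min_rep_def
  proof (intro conjI ballI cI)
    fix x assume x: "x \<in> X"
    then have xI: "x \<in> I" using X by auto
    have "len b < len (s x + b)" using b x by (simp add: min_rep_def)
    also have "\<dots> \<le> len (s x + c) + len d"
      using len_add_le[of "s x + c" d] cI dI xI
      by (simp add: bcd add.assoc add_parabolic s_parabolic)
    finally show "len c < len (s x + c)" using len_b by simp
  qed
  have words: "alt i j m \<in> words J" "alt j i m \<in> words J" "alt i j m \<in> words I" "alt j i m \<in> words I"
    using ij by (simp_all add: J_def alternating_words del: pos_word_simps)
  have elt: "elt (alt i j m) = elt (alt j i m)" using elt_alt_eq[OF e] by (simp add: m_def)
  show ?thesis
  proof (cases "\<exists>x y. fixing_letter X c i = Some x \<and> fixing_letter X c j = Some y")
    case True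
    then obtain x y where xy: "fixing_letter X c i = Some x" "fixing_letter X c j = Some y" by blast
    then have x: "x \<in> X" "conjugate c (s i) = s x" and y: "y \<in> X" "conjugate c (s j) = s y"
      by (simp_all add: fixing_letter_eq_Some_iff[OF X])
    obtain \<delta> where \<delta>: "\<delta> \<in> words J" "elt \<delta> = d" using d by (rule parabolicE)
    have "final_rep X c \<delta> = c"
      using \<delta>(1) xy by (induction \<delta>) (auto simp: J_def)
    then have "b = elt (retract X c \<delta>) + c"
      using elt_retract[OF X, of c \<delta>] \<delta>(2) bcd by simp
    then have "b = c"
      using min_rep_unique[OF X c b] elt_parabolic[OF retract_words[OF X]] by blast
    have xyI: "x \<in> I" "y \<in> I" using x y X by auto
    have "s x \<noteq> s y" using x y ij s_inj[of i j] by (metis conjugate_eq_iff)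
    then have "x \<noteq> y" by blast
    have xyc: "elt (alt x y n) + c = c + elt (alt i j n)" "elt (alt y x n) + c = c + elt (alt j i n)" for n
      using elt_retract[OF X, of c "alt i j n"] elt_retract[OF X, of c "alt j i n"]
      by (simp_all add: retract_alt_fixed xy)
    have xym: "elt (alt x y m) = elt (alt y x m)" using xyc[of m] elt by (metis add_right_cancel)
    have "m > 0" using ij by simp
    then have edge: "{x, y} \<in> edges \<Gamma>" and "label \<Gamma> {x, y} \<le> m"
      using elt_alt_eqD[OF xyI \<open>x \<noteq> y\<close> _ xym] by blast+
    moreover have "elt (alt i j (label \<Gamma> {x, y})) = elt (alt j i (label \<Gamma> {x, y}))"
      using xyc elt_alt_eq[OF edge] by (metis add_left_cancel)
    then have "m \<le> label \<Gamma> {x, y}"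
      using elt_alt_eqD(2)[OF ij(1-3)] edgeD(4)[OF edge] by (simp add: m_def)
    ultimately have "(alt x y m, alt y x m) \<in> braid_relators (full_subgraph \<Gamma> X)"
      using x y by (auto simp: braid_relators_iff)
    then have "([] @ alt x y m @ [], [] @ alt y x m @ []) \<in> art_rel X"
      using x y by (intro pres_rel.relator) (simp_all add: alternating_words del: pos_word_simps(4))
    then show ?thesis using \<open>b = c\<close> by (simp add: retract_alt_fixed xy)
  next
    case False
    then obtain x where x: "\<And>k y. k \<in> J \<Longrightarrow> fixing_letter X c k = Some y \<Longrightarrow> y = x"
      unfolding J_def by (metis insertE option.inject singletonD)
    have "min_rep J (- c)" using a by (simp add: c_def)
    then have "p = (x, True)"
      if xs: "xs = alternating i j m \<or> xs = alternating j i m"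
        and p: "p \<in> set (retract X b (pos_word xs))" for xs p
    proof -
      have "pos_word xs \<in> words J" using xs words by blast
      then obtain k where "k \<in> J" "fixing_letter X c k = Some (fst p)"
        using letters_kept_at_coset_minimum[OF X J \<open>min_rep J (- c)\<close> d] p bcd by blast
      then have "fst p = x" by (rule x)
      moreover have "snd p \<in> snd ` set (retract X b (pos_word xs))" using p by (rule imageI)
      then have "snd p \<in> {True}" using snd_retract snd_pos_word by (meson subsetD)
      ultimately show ?thesis by (simp add: prod_eq_iff)
    qed
    then have "retract X b (alt i j m) = replicate (length (retract X b (alt i j m))) (x, True)"
      "retract X b (alt j i m) = replicate (length (retract X b (alt j i m))) (x, True)"
      by (intro replicate_eqI refl; blast)+
    moreover have "walls 0 (retract X b (alt j i m)) = rev (walls 0 (retract X b (alt i j m)))"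
      using walls_braid[OF ij(1,2) elt, of b] words by (simp add: walls_retract[OF X b] rev_filter)
    then have "length (retract X b (alt j i m)) = length (retract X b (alt i j m))"
      by (metis length_rev length_walls)
    ultimately have "retract X b (alt i j m) = retract X b (alt j i m)" by metis
    then show ?thesis using retract_words[OF X] by (auto intro: pres_rel.refl)
  qed
qed

lemma retract_braid_relators:
  assumes "X \<subseteq> I" "min_rep X b" "Z \<subseteq> I" "(l, r) \<in> braid_relators (full_subgraph \<Gamma> Z)"
  shows "(retract X b l, retract X b r) \<in> art_rel X \<and> elt l = elt r"
  using assms retract_braid braid_relator_elt by (auto simp: braid_relators_iff)

lemma retract_art_rel:
  assumes "X \<subseteq> I" "Z \<subseteq> I" "(u, v) \<in> art_rel Z" "min_rep X b"
  shows "(retract X b u, retract X b v) \<in> art_rel X"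
  using retract_respects[OF assms] retract_braid_relators assms by blast

lemma retract_cox_rel:
  assumes X: "X \<subseteq> I" and Z: "Z \<subseteq> I" and "(u, v) \<in> cox_rel Z" "min_rep X b"
  shows "(retract X b u, retract X b v) \<in> cox_rel X"
  using assms
proof (rule retract_respects)
  fix l r b
  assume lr: "(l, r) \<in> coxeter_relators (full_subgraph \<Gamma> Z)" "l \<in> words Z" "r \<in> words Z" "min_rep X b"
  show "(retract X b l, retract X b r) \<in> cox_rel X \<and> elt l = elt r"
  proof (cases "(l, r) \<in> braid_relators (full_subgraph \<Gamma> Z)")
    case True
    then show ?thesis
      using retract_braid_relators[OF X lr(4) Z]
      by (auto simp: coxeter_relators_def intro: pres_rel_mono[OF order_refl, rotated])
  next
    case False
    then obtain i where i: "l = [(i, True), (i, True)]" "r = []" "i \<in> I"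
      using lr(1) Z by (auto simp: coxeter_relators_def full_subgraph_def)
    show ?thesis
    proof (cases "fixing_letter X b i")
      case None
      then show ?thesis using i by (auto intro: pres_rel.refl)
    next
      case (Some x)
      then have "x \<in> X" by (simp add: fixing_letter_eq_Some_iff[OF X])
      then have "([] @ [(x, True), (x, True)] @ [], [] @ [] @ []) \<in> cox_rel X"
        by (intro pres_rel.relator) (auto simp: coxeter_relators_def full_subgraph_def)
      then show ?thesis using Some i by simp
    qed
  qed
qed

text \<open>Since the retraction is the identity on words over \<open>Z\<close>, it follows that the Coxeter group
  presented on \<open>Z\<close> embeds into \<open>W\<close>.\<close>

lemma cox_rel_iff:
  assumes Z: "Z \<subseteq> I" and uv: "u \<in> words Z" "v \<in> words Z"
  shows "(u, v) \<in> cox_rel Z \<longleftrightarrow> elt u = elt v"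
proof -
  have uvI: "u \<in> words I" "v \<in> words I" using uv words_mono[OF Z] by auto
  have "(u, v) \<in> cox_rel Z \<longleftrightarrow> (u, v) \<in> cox_rel I"
    using pres_rel_mono[OF Z coxeter_relators_mono[OF Z]]
      retract_cox_rel[OF Z order_refl _ min_rep_0[OF Z], of u v] retract_id[OF Z] uv by auto
  then show ?thesis using elt_eq_iff uvI by simp
qed


section \<open>The groups of subgraphs in terms of words\<close>

lemma artin_elt_eq_iff:
  "u \<in> words Z \<Longrightarrow> v \<in> words Z \<Longrightarrow> artin_elt \<Gamma> Z u = artin_elt \<Gamma> Z v \<longleftrightarrow> (u, v) \<in> art_rel Z"
  by (simp add: artin_elt_def pres_class_eq_iff)

lemma coxeter_elt_eq_iff:
  "Z \<subseteq> I \<Longrightarrow> u \<in> words Z \<Longrightarrow> v \<in> words Z \<Longrightarrow>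
    coxeter_elt \<Gamma> Z u = coxeter_elt \<Gamma> Z v \<longleftrightarrow> elt u = elt v"
  by (simp add: coxeter_elt_def pres_class_eq_iff cox_rel_iff)

lemma inv_coxeter_elt:
  assumes "Z \<subseteq> I" "\<omega> \<in> words Z"
  shows "inv\<^bsub>coxeter \<Gamma> Z\<^esub> coxeter_elt \<Gamma> Z \<omega> = coxeter_elt \<Gamma> Z (rev \<omega>)"
proof (rule group.inv_equality[OF group_coxeter])
  have "\<omega> \<in> words I" using assms words_mono by auto
  then show "coxeter_elt \<Gamma> Z (rev \<omega>) \<otimes>\<^bsub>coxeter \<Gamma> Z\<^esub> coxeter_elt \<Gamma> Z \<omega> = \<one>\<^bsub>coxeter \<Gamma> Z\<^esub>"
    using assms by (simp add: mult_coxeter_elt one_coxeter coxeter_elt_eq_iff elt_rev)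
qed (use assms in \<open>auto simp: carrier_coxeter\<close>)

lemma elt_pos_word_map_fst: "elt (pos_word (map fst \<omega>)) = elt \<omega>"
  by (induction \<omega>) auto

lemma coxeter_length_elt:
  assumes Z: "Z \<subseteq> I" and \<omega>: "\<omega> \<in> words Z"
  shows "coxeter_length \<Gamma> Z (coxeter_elt \<Gamma> Z \<omega>) = len (elt \<omega>)"
  unfolding coxeter_length_def
proof (rule Least_equality)
  obtain \<eta> where \<eta>: "\<eta> \<in> words Z" "length \<eta> = len (elt \<omega>)" "elt \<eta> = elt \<omega>"
    using Z elt_parabolic[OF \<omega>] by (rule parabolic_geodesicE)
  then have "map fst \<eta> \<in> lists Z" by (auto simp: words_def in_lists_conv_set)
  moreover from this have "pos_word (map fst \<eta>) \<in> words Z" by (auto simp: in_lists_conv_set)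
  ultimately show "\<exists>xs\<in>lists Z. length xs = len (elt \<omega>) \<and>
      coxeter_elt \<Gamma> Z (pos_word xs) = coxeter_elt \<Gamma> Z \<omega>"
    using \<eta> Z \<omega> by (intro bexI[of _ "map fst \<eta>"])
      (simp_all only: coxeter_elt_eq_iff elt_pos_word_map_fst length_map)
next
  fix n assume "\<exists>xs\<in>lists Z. length xs = n \<and> coxeter_elt \<Gamma> Z (pos_word xs) = coxeter_elt \<Gamma> Z \<omega>"
  then obtain xs where xs: "set xs \<subseteq> Z" "length xs = n" "elt (pos_word xs) = elt \<omega>"
    using Z \<omega> by (auto simp: coxeter_elt_eq_iff in_lists_conv_set subset_iff)
  then show "len (elt \<omega>) \<le> n" using len_elt_le[of "pos_word xs"] Z by auto
qed

lemma generate_coxeter_gens: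
  assumes "X \<subseteq> Z" "Z \<subseteq> I" "g \<in> generate (coxeter \<Gamma> Z) (coxeter_gens \<Gamma> Z X)"
  shows "\<exists>\<chi>\<in>words X. g = coxeter_elt \<Gamma> Z \<chi>"
  using assms(3)
proof (induction rule: generate.induct)
  case one
  show ?case by (rule bexI[of _ "[]"]) (simp_all add: one_coxeter)
next
  case (incl h)
  then obtain i where "i \<in> X" "h = coxeter_elt \<Gamma> Z [(i, True)]" by (auto simp: coxeter_gens_def)
  then show ?case by (intro bexI[of _ "[(i, True)]"]) simp_all
next
  case (inv h)
  then obtain i where "i \<in> X" "h = coxeter_elt \<Gamma> Z [(i, True)]" by (auto simp: coxeter_gens_def)
  then show ?case
    using assms by (intro bexI[of _ "[(i, True)]"]) (auto simp: inv_coxeter_elt)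
next
  case (eng g h)
  then obtain u v where "u \<in> words X" "g = coxeter_elt \<Gamma> Z u" "v \<in> words X" "h = coxeter_elt \<Gamma> Z v"
    by auto
  moreover from this have "u \<in> words Z" "v \<in> words Z" using words_mono[OF assms(1)] by auto
  ultimately show ?case by (intro bexI[of _ "u @ v"]) (simp_all add: mult_coxeter_elt)
qed

lemma reduced_coxeter_elt:
  assumes X: "X \<subseteq> Z" and Z: "Z \<subseteq> I" and \<omega>: "\<omega> \<in> words Z" and min: "min_rep X (elt \<omega>)"
  shows "reduced \<Gamma> Z X {} (coxeter_elt \<Gamma> Z \<omega>)"
  unfolding reduced_def
proof (intro conjI ballI impI)
  have XI: "X \<subseteq> I" using X Z by simp
  fix w assume w: "w \<in> double_coset \<Gamma> Z X {} (coxeter_elt \<Gamma> Z \<omega>)" "w \<noteq> coxeter_elt \<Gamma> Z \<omega>"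
  have "generate (coxeter \<Gamma> Z) (coxeter_gens \<Gamma> Z {}) = {coxeter_elt \<Gamma> Z []}"
    by (simp add: coxeter_gens_def group.generate_empty[OF group_coxeter] one_coxeter)
  with w(1) obtain g where "g \<in> generate (coxeter \<Gamma> Z) (coxeter_gens \<Gamma> Z X)"
    and wg: "w = g \<otimes>\<^bsub>coxeter \<Gamma> Z\<^esub> coxeter_elt \<Gamma> Z \<omega> \<otimes>\<^bsub>coxeter \<Gamma> Z\<^esub> coxeter_elt \<Gamma> Z []"
    by (auto simp: double_coset_def r_coset_def set_mult_def)
  then obtain \<chi> where \<chi>: "\<chi> \<in> words X" "g = coxeter_elt \<Gamma> Z \<chi>"
    using generate_coxeter_gens[OF X Z] by blast
  have \<chi>Z: "\<chi> \<in> words Z" "\<chi> \<in> words I" using \<chi> words_mono[OF X] words_mono[OF XI] by auto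
  have w_elt: "w = coxeter_elt \<Gamma> Z (\<chi> @ \<omega>)" using wg \<chi> \<chi>Z \<omega> by (simp add: mult_coxeter_elt)
  then have "elt \<chi> \<noteq> 0" using w(2) Z \<chi>Z \<omega> by (auto simp: coxeter_elt_eq_iff)
  then have "len (elt \<chi>) > 0" using len_eq_0_iff[OF elt_parabolic[OF \<chi>Z(2)]] by simp
  moreover have "len (elt (\<chi> @ \<omega>)) = len (elt \<chi>) + len (elt \<omega>)"
    using min_rep_len_add[OF XI min elt_parabolic[OF \<chi>(1)]] by simp
  ultimately show "coxeter_length \<Gamma> Z (coxeter_elt \<Gamma> Z \<omega>) < coxeter_length \<Gamma> Z w"
    using w_elt coxeter_length_elt[OF Z] \<chi>Z \<omega> by simp
qed (use \<omega> in \<open>auto simp: carrier_coxeter\<close>)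

lemma artin_pos_eq: "artin_pos \<Gamma> Z = artin_elt \<Gamma> Z ` pos_word ` lists Z"
  unfolding artin_pos_def
proof (rule hull_unique)
  show "artin_gens \<Gamma> Z \<subseteq> artin_elt \<Gamma> Z ` pos_word ` lists Z"
  proof
    fix g assume "g \<in> artin_gens \<Gamma> Z"
    then obtain i where "i \<in> Z" "g = artin_elt \<Gamma> Z [(i, True)]"
      unfolding artin_gens_def by (rule imageE)
    then have "g = artin_elt \<Gamma> Z (pos_word [i])" "[i] \<in> lists Z" by simp_all
    then show "g \<in> artin_elt \<Gamma> Z ` pos_word ` lists Z" by blast
  qed
  show "submonoid (artin_elt \<Gamma> Z ` pos_word ` lists Z) (artin \<Gamma> Z)"
  proof
    show "artin_elt \<Gamma> Z ` pos_word ` lists Z \<subseteq> carrier (artin \<Gamma> Z)"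
      by (auto simp: carrier_artin intro!: imageI)
    show "\<one>\<^bsub>artin \<Gamma> Z\<^esub> \<in> artin_elt \<Gamma> Z ` pos_word ` lists Z"
      by (auto simp: one_artin intro!: image_eqI[of _ _ "[]"])
    fix g h
    assume "g \<in> artin_elt \<Gamma> Z ` pos_word ` lists Z" "h \<in> artin_elt \<Gamma> Z ` pos_word ` lists Z"
    then obtain xs ys where "xs \<in> lists Z" "g = artin_elt \<Gamma> Z (pos_word xs)"
      "ys \<in> lists Z" "h = artin_elt \<Gamma> Z (pos_word ys)" by auto
    moreover from this have "pos_word xs \<in> words Z" "pos_word ys \<in> words Z" by auto
    ultimately have "g \<otimes>\<^bsub>artin \<Gamma> Z\<^esub> h = artin_elt \<Gamma> Z (pos_word (xs @ ys))" "xs @ ys \<in> lists Z"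
      by (simp_all add: mult_artin_elt pos_word_append)
    then show "g \<otimes>\<^bsub>artin \<Gamma> Z\<^esub> h \<in> artin_elt \<Gamma> Z ` pos_word ` lists Z" by blast
  qed
next
  fix M assume gens: "artin_gens \<Gamma> Z \<subseteq> M" and "submonoid M (artin \<Gamma> Z)"
  then interpret M: submonoid M "artin \<Gamma> Z" by simp
  have "artin_elt \<Gamma> Z (pos_word xs) \<in> M" if "xs \<in> lists Z" for xs
    using that
  proof (induction xs)
    case Nil
    then show ?case using M.one_closed by (simp add: one_artin)
  next
    case (Cons i xs)
    then have "artin_elt \<Gamma> Z [(i, True)] \<in> M" using gens by (auto simp: artin_gens_def)
    with Cons have "artin_elt \<Gamma> Z [(i, True)] \<otimes>\<^bsub>artin \<Gamma> Z\<^esub> artin_elt \<Gamma> Z (pos_word xs) \<in> M"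
      by (intro M.m_closed) auto
    moreover have "set xs \<subseteq> Z" using Cons by auto
    ultimately show ?case using Cons by (simp add: mult_artin_elt)
  qed
  then show "artin_elt \<Gamma> Z ` pos_word ` lists Z \<subseteq> M" by blast
qed

lemma colored_artin_iff:
  assumes "Z \<subseteq> I" "\<omega> \<in> words Z"
  shows "artin_elt \<Gamma> Z \<omega> \<in> colored_artin \<Gamma> Z \<longleftrightarrow> elt \<omega> = 0"
  using assms
  by (auto simp: colored_artin_def kernel_def carrier_artin theta_artin_elt one_coxeter coxeter_elt_eq_iff)

lemma colored_artinE:
  assumes "Z \<subseteq> I" "g \<in> colored_artin \<Gamma> Z"
  obtains \<omega> where "\<omega> \<in> words Z" "g = artin_elt \<Gamma> Z \<omega>" "elt \<omega> = 0"
proof -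
  from assms(2) obtain \<omega> where "\<omega> \<in> words Z" "g = artin_elt \<Gamma> Z \<omega>"
    by (auto simp: colored_artin_def kernel_def carrier_artin)
  then show ?thesis using that colored_artin_iff assms by blast
qed

text \<open>A word representing an element of the coloured group ends at the coset representative at which
  it started. This makes the retraction multiplicative.\<close>

lemma final_rep_colored:
  assumes X: "X \<subseteq> I" and "\<omega> \<in> words I" "elt \<omega> = 0"
  shows "final_rep X 0 \<omega> = 0" "elt (retract X 0 \<omega>) = 0"
proof -
  have "final_rep X 0 \<omega> = final_rep X 0 []"
    using assms by (intro final_rep_eq[OF X min_rep_0[OF X]]) auto
  then show "final_rep X 0 \<omega> = 0" by simp
  then show "elt (retract X 0 \<omega>) = 0" using elt_retract[OF X, of 0 \<omega>] assms(3) by simp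
qed

text \<open>The retraction does not depend on the ambient set \<open>Z\<close>, which only determines the group on which
  the induced map is defined.\<close>

definition retraction :: "'i set \<Rightarrow> 'i set \<Rightarrow> 'i word set \<Rightarrow> 'i word set"
  where "retraction Z X g = artin_elt \<Gamma> X (retract X 0 (SOME \<omega>. \<omega> \<in> words Z \<and> artin_elt \<Gamma> Z \<omega> = g))"

lemma artin_elt_retract_cong:
  assumes "Z \<subseteq> I" "X \<subseteq> Z" "u \<in> words Z" "v \<in> words Z" "artin_elt \<Gamma> Z u = artin_elt \<Gamma> Z v"
  shows "artin_elt \<Gamma> X (retract X 0 u) = artin_elt \<Gamma> X (retract X 0 v)"
proof -
  have X: "X \<subseteq> I" using assms by auto
  then have "(retract X 0 u, retract X 0 v) \<in> art_rel X"
    using retract_art_rel[OF X assms(1) _ min_rep_0] assms by (simp add: artin_elt_eq_iff)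
  then show ?thesis using retract_words[OF X] by (simp add: artin_elt_eq_iff)
qed

lemma retraction_artin_elt:
  assumes "Z \<subseteq> I" "X \<subseteq> Z" "\<omega> \<in> words Z"
  shows "retraction Z X (artin_elt \<Gamma> Z \<omega>) = artin_elt \<Gamma> X (retract X 0 \<omega>)"
proof -
  have "\<exists>\<eta>. \<eta> \<in> words Z \<and> artin_elt \<Gamma> Z \<eta> = artin_elt \<Gamma> Z \<omega>" using assms(3) by blast
  from someI_ex[OF this] show ?thesis
    unfolding retraction_def using artin_elt_retract_cong[OF assms(1,2) _ assms(3)] by blast
qed

lemma retraction_mult:
  assumes Z: "Z \<subseteq> I" and X: "X \<subseteq> Z" and \<omega>: "\<omega> \<in> words Z" and g: "g \<in> carrier (artin \<Gamma> Z)"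
    and "final_rep X 0 \<omega> = 0"
  shows "retraction Z X (artin_elt \<Gamma> Z \<omega> \<otimes>\<^bsub>artin \<Gamma> Z\<^esub> g) =
    retraction Z X (artin_elt \<Gamma> Z \<omega>) \<otimes>\<^bsub>artin \<Gamma> X\<^esub> retraction Z X g"
proof -
  obtain \<eta> where \<eta>: "\<eta> \<in> words Z" "g = artin_elt \<Gamma> Z \<eta>" using g by (auto simp: carrier_artin)
  have "X \<subseteq> I" using X Z by simp
  then show ?thesis
    using assms \<eta> by (simp add: mult_artin_elt retraction_artin_elt retract_append retract_words)
qed

lemma retraction_reduced:
  assumes Z: "Z \<subseteq> I" and X: "X \<subseteq> Z" and g: "g \<in> carrier (artin \<Gamma> Z)"
  defines "v \<equiv> coxeter_incl \<Gamma> Z (theta \<Gamma> X (retraction Z X g))"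
  defines "w \<equiv> inv\<^bsub>coxeter \<Gamma> Z\<^esub> v \<otimes>\<^bsub>coxeter \<Gamma> Z\<^esub> theta \<Gamma> Z g"
  shows "reduced \<Gamma> Z X {} w"
    "coxeter_length \<Gamma> Z (theta \<Gamma> Z g) = coxeter_length \<Gamma> Z v + coxeter_length \<Gamma> Z w"
proof -
  have XI: "X \<subseteq> I" using X Z by simp
  obtain \<omega> where \<omega>: "\<omega> \<in> words Z" "g = artin_elt \<Gamma> Z \<omega>" using g by (auto simp: carrier_artin)
  define \<eta> where "\<eta> = retract X 0 \<omega>"
  have \<eta>: "\<eta> \<in> words X" "\<eta> \<in> words Z"
    using retract_words[OF XI] words_mono[OF X] by (auto simp: \<eta>_def)
  have \<omega>I: "\<omega> \<in> words I" "\<eta> \<in> words I" using \<omega> \<eta> words_mono[OF Z] by auto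
  have v: "v = coxeter_elt \<Gamma> Z \<eta>"
    using X Z \<omega> \<eta>
    by (simp add: v_def retraction_artin_elt theta_artin_elt coxeter_incl_coxeter_elt flip: \<eta>_def)
  have w: "w = coxeter_elt \<Gamma> Z (rev \<eta> @ \<omega>)"
    using v Z \<omega> \<eta> by (simp add: w_def inv_coxeter_elt mult_coxeter_elt theta_artin_elt)
  have split: "elt \<omega> = elt \<eta> + final_rep X 0 \<omega>"
    using elt_retract[OF XI, of 0 \<omega>] by (simp add: \<eta>_def)
  then have final: "elt (rev \<eta> @ \<omega>) = final_rep X 0 \<omega>"
    using \<omega>I by (simp add: elt_rev)
  have min: "min_rep X (final_rep X 0 \<omega>)"
    using final_rep_min_rep[OF XI min_rep_0[OF XI] \<omega>I(1)] .
  show "reduced \<Gamma> Z X {} w"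
    unfolding w using \<omega> \<eta> min final by (intro reduced_coxeter_elt[OF X Z]) simp_all
  have "len (elt \<omega>) = len (elt \<eta>) + len (elt (rev \<eta> @ \<omega>))"
    using min_rep_len_add[OF XI min elt_parabolic[OF \<eta>(1)]] split final by simp
  then show "coxeter_length \<Gamma> Z (theta \<Gamma> Z g) = coxeter_length \<Gamma> Z v + coxeter_length \<Gamma> Z w"
    using coxeter_length_elt[OF Z] \<omega> \<eta> v w by (simp add: theta_artin_elt)
qed

lemma retraction_colored_hom:
  assumes Z: "Z \<subseteq> I" and X: "X \<subseteq> Z"
  shows "retraction Z X \<in> hom (artin \<Gamma> Z\<lparr>carrier := colored_artin \<Gamma> Z\<rparr>)
    (artin \<Gamma> X\<lparr>carrier := colored_artin \<Gamma> X\<rparr>)"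
proof (rule homI)
  have XI: "X \<subseteq> I" using X Z by simp
  fix g assume "g \<in> carrier (artin \<Gamma> Z\<lparr>carrier := colored_artin \<Gamma> Z\<rparr>)"
  then have "g \<in> colored_artin \<Gamma> Z" by simp
  with Z obtain \<omega> where \<omega>: "\<omega> \<in> words Z" "g = artin_elt \<Gamma> Z \<omega>" "elt \<omega> = 0"
    by (rule colored_artinE)
  have \<omega>I: "\<omega> \<in> words I" using \<omega> words_mono[OF Z] by auto
  show "retraction Z X g \<in> carrier (artin \<Gamma> X\<lparr>carrier := colored_artin \<Gamma> X\<rparr>)"
    using assms \<omega> final_rep_colored[OF XI \<omega>I] retract_words[OF XI]
    by (simp add: retraction_artin_elt colored_artin_iff[OF XI])
  fix h assume "h \<in> carrier (artin \<Gamma> Z\<lparr>carrier := colored_artin \<Gamma> Z\<rparr>)"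
  then have "h \<in> carrier (artin \<Gamma> Z)" by (simp add: colored_artin_def kernel_def)
  then show "retraction Z X (g \<otimes>\<^bsub>artin \<Gamma> Z\<lparr>carrier := colored_artin \<Gamma> Z\<rparr>\<^esub> h) =
      retraction Z X g \<otimes>\<^bsub>artin \<Gamma> X\<lparr>carrier := colored_artin \<Gamma> X\<rparr>\<^esub> retraction Z X h"
    using retraction_mult[OF Z X \<omega>(1)] final_rep_colored[OF XI \<omega>I \<omega>(3)] \<omega>(2) by simp
qed

lemma retract_positive:
  assumes "X \<subseteq> I"
  shows "\<exists>ys\<in>lists X. retract X b (pos_word xs) = pos_word ys"
proof (induction xs arbitrary: b)
  case (Cons i xs)
  show ?case
  proof (cases "fixing_letter X b i")
    case (Some x)
    then have "x \<in> X" by (simp add: fixing_letter_eq_Some_iff[OF assms])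
    moreover obtain ys where "ys \<in> lists X" "retract X b (pos_word xs) = pos_word ys" using Cons by blast
    ultimately show ?thesis using Some by (intro bexI[of _ "x # ys"]) auto
  qed (use Cons in simp)
qed (auto intro!: bexI[of _ "[]"])

lemma retraction_artin_pos:
  assumes Z: "Z \<subseteq> I" and X: "X \<subseteq> Z"
  shows "retraction Z X ` artin_pos \<Gamma> Z = artin_pos \<Gamma> X"
proof
  have XI: "X \<subseteq> I" using X Z by simp
  show "retraction Z X ` artin_pos \<Gamma> Z \<subseteq> artin_pos \<Gamma> X"
  proof
    fix g assume "g \<in> retraction Z X ` artin_pos \<Gamma> Z"
    then obtain xs where xs: "xs \<in> lists Z" "g = retraction Z X (artin_elt \<Gamma> Z (pos_word xs))"
      by (auto simp: artin_pos_eq)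
    then have "g = artin_elt \<Gamma> X (retract X 0 (pos_word xs))"
      by (subst retraction_artin_elt[OF Z X, symmetric]) auto
    then show "g \<in> artin_pos \<Gamma> X"
      using retract_positive[OF XI, of 0 xs] by (auto simp: artin_pos_eq)
  qed
  show "artin_pos \<Gamma> X \<subseteq> retraction Z X ` artin_pos \<Gamma> Z"
  proof
    fix g assume "g \<in> artin_pos \<Gamma> X"
    then obtain xs where xs: "xs \<in> lists X" "g = artin_elt \<Gamma> X (pos_word xs)"
      by (auto simp: artin_pos_eq)
    then have words: "pos_word xs \<in> words X" "pos_word xs \<in> words Z" "xs \<in> lists Z" using X by auto
    then have "g = retraction Z X (artin_elt \<Gamma> Z (pos_word xs))"
      using xs by (simp add: retraction_artin_elt[OF Z X] retract_id[OF XI] del: pos_word_simps)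
    then show "g \<in> retraction Z X ` artin_pos \<Gamma> Z" using words(3) by (auto simp: artin_pos_eq)
  qed
qed

end

section \<open>A faithful model\<close>

text \<open>The Coxeter group of the whole graph acts on itself by left multiplication. The bijections of a
  type form an instance of \<open>group_add\<close>, so this provides a model of the type required above.\<close>

typedef 'a bijection = "{f :: 'a \<Rightarrow> 'a. bij f}"
  morphisms apply_bij Bij
  by (auto intro: bij_id)

instantiation bijection :: (type) group_add
begin

definition zero_bijection :: "'a bijection"
  where "0 = Bij id"

definition plus_bijection :: "'a bijection \<Rightarrow> 'a bijection \<Rightarrow> 'a bijection"
  where "f + g = Bij (apply_bij f \<circ> apply_bij g)"

definition uminus_bijection :: "'a bijection \<Rightarrow> 'a bijection"
  where "- f = Bij (inv_into UNIV (apply_bij f))"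

definition minus_bijection :: "'a bijection \<Rightarrow> 'a bijection \<Rightarrow> 'a bijection"
  where "f - g = f + - (g :: 'a bijection)"

lemma bij_apply_bij: "bij (apply_bij f)"
  using apply_bij[of f] by simp

lemma apply_bij_simps:
  "apply_bij 0 = (id :: 'a \<Rightarrow> 'a)"
  "apply_bij (f + g) = apply_bij f \<circ> apply_bij g"
  "apply_bij (- f) = inv_into UNIV (apply_bij f)" for f g :: "'a bijection"
  by (simp_all add: zero_bijection_def plus_bijection_def uminus_bijection_def Bij_inverse
      bij_apply_bij bij_comp bij_imp_bij_inv)

instance
  by standard (simp_all add: apply_bij_inject[symmetric] apply_bij_simps comp_assoc
      bij_is_inj[OF bij_apply_bij] minus_bijection_def)

end

text \<open>Acting trivially outside the carrier makes this a bijection of the whole type.\<close>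

definition left_mult :: "'i lgraph \<Rightarrow> 'i \<Rightarrow> 'i word set bijection"
  where "left_mult \<Gamma> i = Bij (\<lambda>A. if i \<in> verts \<Gamma> \<and> A \<in> carrier (coxeter \<Gamma> (verts \<Gamma>))
    then coxeter_elt \<Gamma> (verts \<Gamma>) [(i, True)] \<otimes>\<^bsub>coxeter \<Gamma> (verts \<Gamma>)\<^esub> A else A)"

lemma coxeter_elt_generator_involution:
  assumes "i \<in> Z"
  shows "coxeter_elt \<Gamma> Z [(i, True), (i, True)] = coxeter_elt \<Gamma> Z []"
proof -
  have "([] @ [(i, True), (i, True)] @ [], [] @ [] @ []) \<in>
      pres_rel Z (coxeter_relators (full_subgraph \<Gamma> Z))"
    using assms by (intro pres_rel.relator)
      (auto simp: coxeter_relators_def full_subgraph_def pos_word_def)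
  then show ?thesis using assms by (simp add: coxeter_elt_def pres_class_eq_iff)
qed

lemma coxeter_elt_sign:
  assumes "i \<in> Z"
  shows "coxeter_elt \<Gamma> Z [(i, b)] = coxeter_elt \<Gamma> Z [(i, True)]"
proof (cases b)
  case False
  have "([] @ [(i, False), (i, \<not> False)] @ [(i, True)], [] @ [(i, True)]) \<in>
      pres_rel Z (coxeter_relators (full_subgraph \<Gamma> Z))"
    using assms by (intro pres_rel.cancel) auto
  then have "coxeter_elt \<Gamma> Z [(i, True)] = coxeter_elt \<Gamma> Z ([(i, False)] @ [(i, True), (i, True)])"
    using assms by (subst eq_commute) (simp add: coxeter_elt_def pres_class_eq_iff)
  also have "\<dots> = coxeter_elt \<Gamma> Z ([(i, False)] @ [])"
    using assms by (simp only: mult_coxeter_elt[symmetric] coxeter_elt_generator_involution words_Cons words_Nil simp_thms)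
  finally show ?thesis using False by simp
qed simp

lemma apply_left_mult:
  "apply_bij (left_mult \<Gamma> i) = (\<lambda>A. if i \<in> verts \<Gamma> \<and> A \<in> carrier (coxeter \<Gamma> (verts \<Gamma>))
    then coxeter_elt \<Gamma> (verts \<Gamma>) [(i, True)] \<otimes>\<^bsub>coxeter \<Gamma> (verts \<Gamma>)\<^esub> A else A)" (is "_ = ?f")
proof -
  interpret C: group "coxeter \<Gamma> (verts \<Gamma>)" by (rule group_coxeter)
  have "?f (?f A) = A" for A
  proof (cases "i \<in> verts \<Gamma> \<and> A \<in> carrier (coxeter \<Gamma> (verts \<Gamma>))")
    case True
    let ?g = "coxeter_elt \<Gamma> (verts \<Gamma>) [(i, True)]"
    have g: "?g \<in> carrier (coxeter \<Gamma> (verts \<Gamma>))" using True by (simp add: carrier_coxeter)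
    have "?g \<otimes>\<^bsub>coxeter \<Gamma> (verts \<Gamma>)\<^esub> ?g = coxeter_elt \<Gamma> (verts \<Gamma>) ([(i, True)] @ [(i, True)])"
      using True by (simp only: mult_coxeter_elt words_Cons words_Nil simp_thms)
    also have "\<dots> = \<one>\<^bsub>coxeter \<Gamma> (verts \<Gamma>)\<^esub>"
      using True coxeter_elt_generator_involution[of i "verts \<Gamma>" \<Gamma>]
      by (simp add: one_coxeter)
    finally show ?thesis using True g by (simp flip: C.m_assoc)
  qed auto
  then have "bij ?f" by (intro o_bij[of ?f ?f]) (auto simp: fun_eq_iff)
  then show ?thesis by (simp add: left_mult_def Bij_inverse)
qed

lemma apply_sum_left_mult:
  assumes "u \<in> words (verts \<Gamma>)" "A \<in> carrier (coxeter \<Gamma> (verts \<Gamma>))"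
  shows "apply_bij (\<Sum>p\<leftarrow>u. left_mult \<Gamma> (fst p)) A =
    coxeter_elt \<Gamma> (verts \<Gamma>) u \<otimes>\<^bsub>coxeter \<Gamma> (verts \<Gamma>)\<^esub> A"
  using assms(1)
proof (induction u)
  case Nil
  interpret C: group "coxeter \<Gamma> (verts \<Gamma>)" by (rule group_coxeter)
  show ?case using assms(2) by (simp add: apply_bij_simps flip: one_coxeter)
next
  case (Cons p u)
  interpret C: group "coxeter \<Gamma> (verts \<Gamma>)" by (rule group_coxeter)
  obtain i b where p: "p = (i, b)" by force
  have i: "i \<in> verts \<Gamma>" and u: "u \<in> words (verts \<Gamma>)" using Cons.prems p by auto
  have carrier: "coxeter_elt \<Gamma> (verts \<Gamma>) v \<in> carrier (coxeter \<Gamma> (verts \<Gamma>))"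
    if "v \<in> words (verts \<Gamma>)" for v
    using that by (simp add: carrier_coxeter)
  have "coxeter_elt \<Gamma> (verts \<Gamma>) (p # u) =
      coxeter_elt \<Gamma> (verts \<Gamma>) [(i, b)] \<otimes>\<^bsub>coxeter \<Gamma> (verts \<Gamma>)\<^esub> coxeter_elt \<Gamma> (verts \<Gamma>) u"
    using mult_coxeter_elt[symmetric, of "[(i, b)]" "verts \<Gamma>" u \<Gamma>] i u p by simp
  also have "\<dots> \<otimes>\<^bsub>coxeter \<Gamma> (verts \<Gamma>)\<^esub> A = coxeter_elt \<Gamma> (verts \<Gamma>) [(i, True)]
      \<otimes>\<^bsub>coxeter \<Gamma> (verts \<Gamma>)\<^esub> (coxeter_elt \<Gamma> (verts \<Gamma>) u \<otimes>\<^bsub>coxeter \<Gamma> (verts \<Gamma>)\<^esub> A)"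
    using i u assms(2) carrier by (simp add: coxeter_elt_sign[OF i, of \<Gamma> b] C.m_assoc)
  also have "\<dots> = apply_bij (left_mult \<Gamma> i) (coxeter_elt \<Gamma> (verts \<Gamma>) u \<otimes>\<^bsub>coxeter \<Gamma> (verts \<Gamma>)\<^esub> A)"
    unfolding apply_left_mult using i carrier[OF u] assms(2) by simp
  also have "\<dots> = apply_bij (\<Sum>p\<leftarrow>p # u. left_mult \<Gamma> (fst p)) A"
    by (simp only: list.map sum_list.Cons apply_bij_simps comp_apply fst_conv p Cons.IH[OF u])
  finally show ?case by (rule HOL.sym)
qed

lemma apply_sum_left_mult_outside:
  "A \<notin> carrier (coxeter \<Gamma> (verts \<Gamma>)) \<Longrightarrow> apply_bij (\<Sum>p\<leftarrow>u. left_mult \<Gamma> (fst p)) A = A"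
proof (induction u)
  case (Cons p u)
  obtain i b where p: "p = (i, b)" by force
  show ?case
    by (simp only: list.map sum_list.Cons apply_bij_simps comp_apply fst_conv p
        Cons.IH[OF Cons.prems] apply_left_mult Cons.prems simp_thms if_False)
qed (simp add: apply_bij_simps)

lemma coxeter_system_left_mult:
  assumes "finite_labelled_graph \<Gamma>"
  shows "coxeter_system \<Gamma> (left_mult \<Gamma>)"
proof
  interpret C: group "coxeter \<Gamma> (verts \<Gamma>)" by (rule group_coxeter)
  fix u v assume uv: "u \<in> words (verts \<Gamma>)" "v \<in> words (verts \<Gamma>)"
  have "(\<Sum>p\<leftarrow>u. left_mult \<Gamma> (fst p)) = (\<Sum>p\<leftarrow>v. left_mult \<Gamma> (fst p))
      \<longleftrightarrow> coxeter_elt \<Gamma> (verts \<Gamma>) u = coxeter_elt \<Gamma> (verts \<Gamma>) v"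
  proof
    assume "(\<Sum>p\<leftarrow>u. left_mult \<Gamma> (fst p)) = (\<Sum>p\<leftarrow>v. left_mult \<Gamma> (fst p))"
    then show "coxeter_elt \<Gamma> (verts \<Gamma>) u = coxeter_elt \<Gamma> (verts \<Gamma>) v"
      using apply_sum_left_mult[OF uv(1) C.one_closed] apply_sum_left_mult[OF uv(2) C.one_closed] uv
      by (simp add: carrier_coxeter)
  next
    assume eq: "coxeter_elt \<Gamma> (verts \<Gamma>) u = coxeter_elt \<Gamma> (verts \<Gamma>) v"
    have "apply_bij (\<Sum>p\<leftarrow>u. left_mult \<Gamma> (fst p)) A = apply_bij (\<Sum>p\<leftarrow>v. left_mult \<Gamma> (fst p)) A" for A
      by (cases "A \<in> carrier (coxeter \<Gamma> (verts \<Gamma>))")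
        (simp_all add: apply_sum_left_mult apply_sum_left_mult_outside uv eq)
    then have "apply_bij (\<Sum>p\<leftarrow>u. left_mult \<Gamma> (fst p)) = apply_bij (\<Sum>p\<leftarrow>v. left_mult \<Gamma> (fst p))"
      by (rule ext)
    then show "(\<Sum>p\<leftarrow>u. left_mult \<Gamma> (fst p)) = (\<Sum>p\<leftarrow>v. left_mult \<Gamma> (fst p))"
      by (simp only: apply_bij_inject)
  qed
  also have "\<dots> \<longleftrightarrow> (u, v) \<in> pres_rel (verts \<Gamma>) (coxeter_relators (full_subgraph \<Gamma> (verts \<Gamma>)))"
    using uv by (simp add: coxeter_elt_def pres_class_eq_iff)
  finally show "(\<Sum>p\<leftarrow>u. left_mult \<Gamma> (fst p)) = (\<Sum>p\<leftarrow>v. left_mult \<Gamma> (fst p))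
      \<longleftrightarrow> (u, v) \<in> pres_rel (verts \<Gamma>) (coxeter_relators (full_subgraph \<Gamma> (verts \<Gamma>)))" .
qed (rule assms)

section \<open>The family of retractions\<close>

theorem proposition0p2:
  fixes \<Gamma> :: "'i lgraph"
  assumes "finite_labelled_graph \<Gamma>"
  shows "\<exists>(\<pi>s :: 'i set \<Rightarrow> 'i set \<Rightarrow> 'i word \<Rightarrow> 'i word)
          (\<pi> :: 'i set \<Rightarrow> 'i set \<Rightarrow> 'i word set \<Rightarrow> 'i word set).
    \<forall>Z X. Z \<subseteq> verts \<Gamma> \<longrightarrow> X \<subseteq> Z \<longrightarrow>
      \<pi>s Z X \<in> words Z \<rightarrow> words X \<and>
      \<comment> \<open>(i)\<close>
      (\<forall>\<omega>\<in>words Z.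
        length (\<pi>s Z X \<omega>) \<le> length \<omega> \<and>
        (length (\<pi>s Z X \<omega>) = length \<omega> \<longleftrightarrow> \<omega> \<in> words X) \<and>
        (\<omega> \<in> words X \<longrightarrow> \<pi>s Z X \<omega> = \<omega>)) \<and>
      \<comment> \<open>(ii)\<close>
      (\<forall>\<omega>\<in>words Z. \<forall>\<omega>'\<in>words Z. prefix (\<pi>s Z X \<omega>) (\<pi>s Z X (\<omega> @ \<omega>'))) \<and>
      \<comment> \<open>(iii)\<close>
      (\<forall>\<omega>\<in>words Z. \<forall>\<omega>'\<in>words Z. artin_elt \<Gamma> Z \<omega> = artin_elt \<Gamma> Z \<omega>' \<longrightarrow>
        artin_elt \<Gamma> X (\<pi>s Z X \<omega>) = artin_elt \<Gamma> X (\<pi>s Z X \<omega>')) \<and>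
      \<pi> Z X \<in> carrier (artin \<Gamma> Z) \<rightarrow> carrier (artin \<Gamma> X) \<and>
      (\<forall>\<omega>\<in>words Z. \<pi> Z X (artin_elt \<Gamma> Z \<omega>) = artin_elt \<Gamma> X (\<pi>s Z X \<omega>)) \<and>
      \<comment> \<open>(iv)\<close>
      (\<forall>g\<in>carrier (artin \<Gamma> Z).
        let v = coxeter_incl \<Gamma> Z (theta \<Gamma> X (\<pi> Z X g));
            w = inv\<^bsub>coxeter \<Gamma> Z\<^esub> v \<otimes>\<^bsub>coxeter \<Gamma> Z\<^esub> theta \<Gamma> Z g
        in reduced \<Gamma> Z X {} w \<and>
           coxeter_length \<Gamma> Z (theta \<Gamma> Z g) = coxeter_length \<Gamma> Z v + coxeter_length \<Gamma> Z w) \<and>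
      \<comment> \<open>(v)\<close>
      \<pi> Z X \<in> hom (artin \<Gamma> Z\<lparr>carrier := colored_artin \<Gamma> Z\<rparr>)
                  (artin \<Gamma> X\<lparr>carrier := colored_artin \<Gamma> X\<rparr>) \<and>
      \<comment> \<open>(vi)\<close>
      \<pi> Z X ` artin_pos \<Gamma> Z = artin_pos \<Gamma> X \<and>
      \<comment> \<open>(vii)\<close>
      (\<forall>\<omega>\<in>words X. \<forall>g'\<in>carrier (artin \<Gamma> Z).
        \<pi> Z X (artin_elt \<Gamma> Z \<omega> \<otimes>\<^bsub>artin \<Gamma> Z\<^esub> g') =
        \<pi> Z X (artin_elt \<Gamma> Z \<omega>) \<otimes>\<^bsub>artin \<Gamma> X\<^esub> \<pi> Z X g') \<and>
      \<comment> \<open>(viii)\<close>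
      (\<forall>g\<in>colored_artin \<Gamma> Z. \<forall>g'\<in>carrier (artin \<Gamma> Z).
        \<pi> Z X (g \<otimes>\<^bsub>artin \<Gamma> Z\<^esub> g') = \<pi> Z X g \<otimes>\<^bsub>artin \<Gamma> X\<^esub> \<pi> Z X g') \<and>
      \<comment> \<open>(ix)\<close>
      (\<forall>Y\<subseteq>Z. \<forall>\<omega>\<in>words Y.
        \<pi>s Z X \<omega> \<in> words (Y \<inter> X) \<and> \<pi>s Z X \<omega> = \<pi>s Y (Y \<inter> X) \<omega>) \<and>
      \<comment> \<open>(x)\<close>
      (\<forall>Y\<subseteq>Z. \<forall>\<omega>\<in>words Z.
        \<pi>s Z Y (\<pi>s Z X \<omega>) = \<pi>s Z (X \<inter> Y) \<omega> \<and> \<pi>s Z X (\<pi>s Z Y \<omega>) = \<pi>s Z (X \<inter> Y) \<omega>) \<and>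
      \<comment> \<open>(xi)\<close>
      (\<forall>Y. X \<subseteq> Y \<longrightarrow> Y \<subseteq> Z \<longrightarrow> (\<forall>\<omega>\<in>words Z. \<pi>s Y X (\<pi>s Z Y \<omega>) = \<pi>s Z X \<omega>))"
proof -
  interpret coxeter_system \<Gamma> "left_mult \<Gamma>" using assms by (rule coxeter_system_left_mult)
  show ?thesis
  proof (intro exI[of _ "\<lambda>Z X. retract X 0"] exI[of _ retraction] allI impI, goal_cases)
    case (1 Z X)
    then have Z: "Z \<subseteq> I" and X: "X \<subseteq> Z" by simp_all
    then have XI: "X \<subseteq> I" by simp
    have ZI: "\<omega> \<in> words I" if "\<omega> \<in> words Z" for \<omega> :: "'i word"
      using that words_mono[OF Z] by auto
    have XZ: "\<omega> \<in> words Z" if "\<omega> \<in> words X" for \<omega> :: "'i word"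
      using that words_mono[OF X] by auto
    have into: "retract X 0 \<in> words Z \<rightarrow> words X" using retract_words[OF XI] by blast
    have i: "\<forall>\<omega>\<in>words Z. length (retract X 0 \<omega>) \<le> length \<omega> \<and>
        (length (retract X 0 \<omega>) = length \<omega> \<longleftrightarrow> \<omega> \<in> words X) \<and>
        (\<omega> \<in> words X \<longrightarrow> retract X 0 \<omega> = \<omega>)"
      using length_retract length_retract_eqD[OF XI] retract_id[OF XI] ZI by auto
    have ii: "\<forall>\<omega>\<in>words Z. \<forall>\<omega>'\<in>words Z. prefix (retract X 0 \<omega>) (retract X 0 (\<omega> @ \<omega>'))"
      by (simp add: retract_append)
    have iii: "\<forall>\<omega>\<in>words Z. \<forall>\<omega>'\<in>words Z. artin_elt \<Gamma> Z \<omega> = artin_elt \<Gamma> Z \<omega>' \<longrightarrow>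
        artin_elt \<Gamma> X (retract X 0 \<omega>) = artin_elt \<Gamma> X (retract X 0 \<omega>')"
      using artin_elt_retract_cong[OF Z X] by blast
    have induced: "\<forall>\<omega>\<in>words Z. retraction Z X (artin_elt \<Gamma> Z \<omega>) = artin_elt \<Gamma> X (retract X 0 \<omega>)"
      using retraction_artin_elt[OF Z X] by blast
    have carrier: "retraction Z X \<in> carrier (artin \<Gamma> Z) \<rightarrow> carrier (artin \<Gamma> X)"
      using induced retract_words[OF XI] by (auto simp: carrier_artin)
    have iv: "\<forall>g\<in>carrier (artin \<Gamma> Z).
        let v = coxeter_incl \<Gamma> Z (theta \<Gamma> X (retraction Z X g));
            w = inv\<^bsub>coxeter \<Gamma> Z\<^esub> v \<otimes>\<^bsub>coxeter \<Gamma> Z\<^esub> theta \<Gamma> Z g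
        in reduced \<Gamma> Z X {} w \<and>
           coxeter_length \<Gamma> Z (theta \<Gamma> Z g) = coxeter_length \<Gamma> Z v + coxeter_length \<Gamma> Z w"
      unfolding Let_def using retraction_reduced[OF Z X] by blast
    have vii: "\<forall>\<omega>\<in>words X. \<forall>g'\<in>carrier (artin \<Gamma> Z).
        retraction Z X (artin_elt \<Gamma> Z \<omega> \<otimes>\<^bsub>artin \<Gamma> Z\<^esub> g') =
        retraction Z X (artin_elt \<Gamma> Z \<omega>) \<otimes>\<^bsub>artin \<Gamma> X\<^esub> retraction Z X g'"
      using retraction_mult[OF Z X] final_rep_id[OF XI] XZ by blast
    have viii: "\<forall>g\<in>colored_artin \<Gamma> Z. \<forall>g'\<in>carrier (artin \<Gamma> Z).
        retraction Z X (g \<otimes>\<^bsub>artin \<Gamma> Z\<^esub> g') =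
        retraction Z X g \<otimes>\<^bsub>artin \<Gamma> X\<^esub> retraction Z X g'"
    proof (intro ballI)
      fix g g' assume "g \<in> colored_artin \<Gamma> Z" and g': "g' \<in> carrier (artin \<Gamma> Z)"
      from Z this(1) obtain \<omega> where "\<omega> \<in> words Z" "g = artin_elt \<Gamma> Z \<omega>" "elt \<omega> = 0"
        by (rule colored_artinE)
      then show "retraction Z X (g \<otimes>\<^bsub>artin \<Gamma> Z\<^esub> g') =
          retraction Z X g \<otimes>\<^bsub>artin \<Gamma> X\<^esub> retraction Z X g'"
        using retraction_mult[OF Z X _ g'] final_rep_colored[OF XI] ZI by blast
    qed
    have ix: "\<forall>Y\<subseteq>Z. \<forall>\<omega>\<in>words Y.
        retract X 0 \<omega> \<in> words (Y \<inter> X) \<and> retract X 0 \<omega> = retract (Y \<inter> X) 0 \<omega>"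
    proof (intro allI impI ballI)
      fix Y and \<omega> :: "'i word" assume Y: "Y \<subseteq> Z" and \<omega>: "\<omega> \<in> words Y"
      have "retract X 0 \<omega> = retract (Y \<inter> X) 0 \<omega>"
        using retract_words_Int[OF XI _ \<omega>] Y Z by blast
      then show "retract X 0 \<omega> \<in> words (Y \<inter> X) \<and> retract X 0 \<omega> = retract (Y \<inter> X) 0 \<omega>"
        using retract_words[of "Y \<inter> X" 0 \<omega>] XI by auto
    qed
    have x: "\<forall>Y\<subseteq>Z. \<forall>\<omega>\<in>words Z. retract Y 0 (retract X 0 \<omega>) = retract (X \<inter> Y) 0 \<omega> \<and>
        retract X 0 (retract Y 0 \<omega>) = retract (X \<inter> Y) 0 \<omega>"
    proof (intro allI impI ballI)
      fix Y and \<omega> :: "'i word" assume "Y \<subseteq> Z" and \<omega>: "\<omega> \<in> words Z"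
      then have "Y \<subseteq> I" using Z by simp
      then show "retract Y 0 (retract X 0 \<omega>) = retract (X \<inter> Y) 0 \<omega> \<and>
          retract X 0 (retract Y 0 \<omega>) = retract (X \<inter> Y) 0 \<omega>"
        using retract_retract[OF XI _ ZI[OF \<omega>]] retract_retract[OF _ XI ZI[OF \<omega>]]
        by (simp add: Int_commute)
    qed
    then have xi: "\<forall>Y. X \<subseteq> Y \<longrightarrow> Y \<subseteq> Z \<longrightarrow>
        (\<forall>\<omega>\<in>words Z. retract X 0 (retract Y 0 \<omega>) = retract X 0 \<omega>)"
      by (metis inf.absorb1)
    show ?case
      by (intro conjI into i ii iii carrier induced iv retraction_colored_hom[OF Z X]
          retraction_artin_pos[OF Z X] vii viii ix x xi)
  qed
qed

end
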